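(* Let $k$ be an algebraically closed field of characteristic not equal to $2$ and let $R=k\llbracket x,y,z\rrbracket/(x^2+z^2)$. Then $\tau_{MCM}(R)=(0)$.
   Context: All rings are commutative, unital, Noetherian and local. A maximal Cohen-Macaulay (MCM) module over a ring $R$ is a finitely generated (nonzero) $R$-module $M$ such that the length of the longest regular sequence on $M$ equals the Krull dimension of $R$; a sequence $x_1,\ldots,x_n$ in $R$ is regular on $M$ if $(x_1,\ldots,x_n)M\ne M$, $x_1$ is a non-zerodivisor on $M$, and $x_i$ is a non-zerodivisor on $M/(x_1,\ldots,x_{i-1})M$ for $2\le i\le n$. For an $R$-module $M$ and $R$-modules $A\subseteq B$, let $A_B^{\mathrm{cl}_M}=\{b\in B : x\otimes b\in \operatorname{im}(M\otimes_R A\to M\otimes_R B)\text{ for all }x\in M\}$. The test ideal of $R$ associated to $M$ is $\tau_M(R)=\bigcap_{A\subseteq B}(A:_R A_B^{\mathrm{cl}_M})$, the intersection over all pairs of $R$-modules $A\subseteq B$. By a known theorem, when $R$ is local and $M$ is finitely generated, $\tau_M(R)$ equals the trace ideal $\sum_{f\in\operatorname{Hom}_R(M,R)}f(M)$, and $\tau_M(R)$ denotes this common ideal. $\tau_{MCM}(R)=\bigcap_M \tau_M(R)$, the intersection over all isomorphism classes of maximal Cohen-Macaulay $R$-modules $M$. *)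

theory Defs
  imports
    "HOL-Algebra.Algebraic_Closure_Type"
    "HOL-Algebra.QuotRing"
    "HOL-Algebra.Module"
    "HOL-Algebra.Free_Abelian_Groups"
    "HOL-Computational_Algebra.Formal_Power_Series"
    "HOL-Computational_Algebra.Polynomial"
    "HOL-Library.Extended_Nat"
begin

section \<open>Krull dimension and maximal Cohen-Macaulay modules\<close>

definition krull_dim :: "('r, 'e) ring_scheme \<Rightarrow> enat" where
  "krull_dim R = Sup {enat n | n. \<exists>P :: nat \<Rightarrow> 'r set.
     (\<forall>i\<le>n. primeideal (P i) R) \<and> (\<forall>i<n. P i \<subset> P (Suc i))}"

definition span_module ::
    "('r, 'e) ring_scheme \<Rightarrow> ('r, 'm, 'f) module_scheme \<Rightarrow> 'm set \<Rightarrow> 'm set" where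
  "span_module R M S = \<Inter>{N. submodule N R M \<and> S \<subseteq> N}"

definition fin_gen_module :: "('r, 'e) ring_scheme \<Rightarrow> ('r, 'm, 'f) module_scheme \<Rightarrow> bool" where
  "fin_gen_module R M \<longleftrightarrow>
     (\<exists>S. finite S \<and> S \<subseteq> carrier M \<and> span_module R M S = carrier M)"

definition ideal_smult ::
    "('r, 'e) ring_scheme \<Rightarrow> 'r set \<Rightarrow> ('r, 'm, 'f) module_scheme \<Rightarrow> 'm set" where
  "ideal_smult R I M = span_module R M {a \<odot>\<^bsub>M\<^esub> m | a m. a \<in> I \<and> m \<in> carrier M}"

text \<open>
  For a submodule \<open>N\<close> of \<open>M\<close>, this says that \<open>a\<close> is a non-zerodivisor on the quotient
  \<open>M/N\<close>: if \<open>a\<close> kills the class of \<open>m\<close>, then the class of \<open>m\<close> is zero.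
\<close>

definition nonzerodivisor_mod ::
    "('r, 'm, 'f) module_scheme \<Rightarrow> 'm set \<Rightarrow> 'r \<Rightarrow> bool" where
  "nonzerodivisor_mod M N a \<longleftrightarrow> (\<forall>m\<in>carrier M. a \<odot>\<^bsub>M\<^esub> m \<in> N \<longrightarrow> m \<in> N)"

text \<open>For \<open>i = 0\<close> the submodule in the last clause is the zero submodule of \<open>M\<close>.\<close>

definition regular_seq ::
    "('r, 'e) ring_scheme \<Rightarrow> ('r, 'm, 'f) module_scheme \<Rightarrow> 'r list \<Rightarrow> bool" where
  "regular_seq R M xs \<longleftrightarrow>
     set xs \<subseteq> carrier R \<and>
     ideal_smult R (Idl\<^bsub>R\<^esub> (set xs)) M \<noteq> carrier M \<and>
     (\<forall>i<length xs.
        nonzerodivisor_mod M (ideal_smult R (Idl\<^bsub>R\<^esub> (set (take i xs))) M) (xs ! i))"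

definition depth_module :: "('r, 'e) ring_scheme \<Rightarrow> ('r, 'm, 'f) module_scheme \<Rightarrow> enat" where
  "depth_module R M = Sup {enat (length xs) | xs. regular_seq R M xs}"

definition MCM :: "('r, 'e) ring_scheme \<Rightarrow> ('r, 'm, 'f) module_scheme \<Rightarrow> bool" where
  "MCM R M \<longleftrightarrow> module R M \<and> fin_gen_module R M \<and> carrier M \<noteq> {\<zero>\<^bsub>M\<^esub>} \<and>
     depth_module R M = krull_dim R"


section \<open>Tensor products\<close>

text \<open>
  The tensor product is the free abelian group on pairs modulo bilinearity and balancedness.
  Only its additive group is recorded: this suffices to speak of elementary tensors and of
  images of induced maps.
\<close>

definition tensor_rels ::
    "('r, 'e) ring_scheme \<Rightarrow> ('r, 'm, 'f) module_scheme \<Rightarrow> ('r, 'n, 'g) module_scheme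
      \<Rightarrow> ('m \<times> 'n \<Rightarrow>\<^sub>0 int) set" where
  "tensor_rels R M N = generate (free_Abelian_group (carrier M \<times> carrier N))
     ({frag_of (x \<oplus>\<^bsub>M\<^esub> x', y) - frag_of (x, y) - frag_of (x', y) | x x' y.
         x \<in> carrier M \<and> x' \<in> carrier M \<and> y \<in> carrier N} \<union>
      {frag_of (x, y \<oplus>\<^bsub>N\<^esub> y') - frag_of (x, y) - frag_of (x, y') | x y y'.
         x \<in> carrier M \<and> y \<in> carrier N \<and> y' \<in> carrier N} \<union>
      {frag_of (a \<odot>\<^bsub>M\<^esub> x, y) - frag_of (x, a \<odot>\<^bsub>N\<^esub> y) | a x y.
         a \<in> carrier R \<and> x \<in> carrier M \<and> y \<in> carrier N})"

definition tensor ::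
    "('r, 'e) ring_scheme \<Rightarrow> ('r, 'm, 'f) module_scheme \<Rightarrow> ('r, 'n, 'g) module_scheme
      \<Rightarrow> ('m \<times> 'n \<Rightarrow>\<^sub>0 int) set monoid" where
  "tensor R M N = free_Abelian_group (carrier M \<times> carrier N) Mod tensor_rels R M N"

definition elem_tensor ::
    "('r, 'e) ring_scheme \<Rightarrow> ('r, 'm, 'f) module_scheme \<Rightarrow> ('r, 'n, 'g) module_scheme
      \<Rightarrow> 'm \<Rightarrow> 'n \<Rightarrow> ('m \<times> 'n \<Rightarrow>\<^sub>0 int) set" where
  "elem_tensor R M N x y =
     tensor_rels R M N #>\<^bsub>free_Abelian_group (carrier M \<times> carrier N)\<^esub> frag_of (x, y)"

text \<open>
  For a submodule \<open>A\<close> of \<open>B\<close> the map \<open>M \<otimes> A \<rightarrow> M \<otimes> B\<close> induced by the inclusion.  The free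
  group on \<open>M \<times> A\<close> is a subgroup of the free group on \<open>M \<times> B\<close>, so the class \<open>C\<close> of \<open>c\<close> in
  \<open>M \<otimes> A\<close> is sent to the class of the same \<open>c\<close> in \<open>M \<otimes> B\<close>, which is the sum of the
  subgroup of relations for \<open>B\<close> and the coset \<open>C\<close>.
\<close>

definition tensor_incl ::
    "('r, 'e) ring_scheme \<Rightarrow> ('r, 'm, 'f) module_scheme \<Rightarrow> ('r, 'n, 'g) module_scheme
      \<Rightarrow> ('m \<times> 'n \<Rightarrow>\<^sub>0 int) set \<Rightarrow> ('m \<times> 'n \<Rightarrow>\<^sub>0 int) set" where
  "tensor_incl R M B C =
     tensor_rels R M B <#>\<^bsub>free_Abelian_group (carrier M \<times> carrier B)\<^esub> C"


section \<open>Test ideals and trace ideals\<close>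

definition module_closure ::
    "('r, 'e) ring_scheme \<Rightarrow> ('r, 'm, 'f) module_scheme \<Rightarrow> ('r, 'n, 'g) module_scheme
      \<Rightarrow> 'n set \<Rightarrow> 'n set" where
  "module_closure R M B A = {b \<in> carrier B. \<forall>x\<in>carrier M.
     elem_tensor R M B x b \<in> tensor_incl R M B ` carrier (tensor R M (B\<lparr>carrier := A\<rparr>))}"

definition module_colon ::
    "('r, 'e) ring_scheme \<Rightarrow> ('r, 'n, 'g) module_scheme \<Rightarrow> 'n set \<Rightarrow> 'n set \<Rightarrow> 'r set" where
  "module_colon R B A C = {r \<in> carrier R. \<forall>c\<in>C. r \<odot>\<^bsub>B\<^esub> c \<in> A}"

text \<open>
  HOL cannot quantify over the modules on all types at once, so modules are taken with elements
  in \<open>(nat \<Rightarrow> 'r) set\<close>.  Every finitely generated module is isomorphic to one of these: embed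
  \<open>R\<^sup>n\<close> in \<open>nat \<Rightarrow> 'r\<close> and pass to the cosets of a submodule.
  The same range suffices for the module \<open>B\<close> below, although \<open>B\<close> is arbitrary there: if \<open>M\<close>
  is finitely generated and \<open>b\<close> lies in the closure of \<open>A\<close> in \<open>B\<close>, then the finitely many
  equations in \<open>M \<otimes> B\<close> that witness this for generators of \<open>M\<close> involve only
  finitely many elements, so \<open>b\<close> already lies in the closure of \<open>A'\<close> in \<open>B'\<close> for some
  finitely generated \<open>A' \<subseteq> A\<close> and \<open>B' \<subseteq> B\<close> with \<open>A' \<subseteq> B'\<close>.
\<close>

type_synonym 'r univ_module = "('r, (nat \<Rightarrow> 'r) set) module"

definition test_ideal :: "'r ring \<Rightarrow> 'r univ_module \<Rightarrow> 'r set" where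
  "test_ideal R M = {r \<in> carrier R. \<forall>(B :: 'r univ_module) A.
     module R B \<and> submodule A R B \<longrightarrow> r \<in> module_colon R B A (module_closure R M B A)}"

definition regular_module :: "'r ring \<Rightarrow> ('r, 'r) module" where
  "regular_module R = \<lparr>carrier = carrier R, monoid.mult = (\<otimes>\<^bsub>R\<^esub>), monoid.one = \<one>\<^bsub>R\<^esub>,
     ring.zero = \<zero>\<^bsub>R\<^esub>, ring.add = (\<oplus>\<^bsub>R\<^esub>), module.smult = (\<otimes>\<^bsub>R\<^esub>)\<rparr>"

definition module_homs ::
    "('r, 'e) ring_scheme \<Rightarrow> ('r, 'm, 'f) module_scheme \<Rightarrow> ('r, 'n, 'g) module_scheme
      \<Rightarrow> ('m \<Rightarrow> 'n) set" where
  "module_homs R M N = {h \<in> hom (add_monoid M) (add_monoid N).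
     \<forall>a\<in>carrier R. \<forall>x\<in>carrier M. h (a \<odot>\<^bsub>M\<^esub> x) = a \<odot>\<^bsub>N\<^esub> h x}"

definition trace_ideal :: "'r ring \<Rightarrow> 'r univ_module \<Rightarrow> 'r set" where
  "trace_ideal R M = Idl\<^bsub>R\<^esub> (\<Union>f\<in>module_homs R M (regular_module R). f ` carrier M)"

text \<open>
  The parameter \<open>\<tau>\<close> is to be \<open>test_ideal\<close> or \<open>trace_ideal\<close>; for finitely generated modules
  over a Noetherian local ring the two agree.
\<close>

definition tau_MCM :: "('r ring \<Rightarrow> 'r univ_module \<Rightarrow> 'r set) \<Rightarrow> 'r ring \<Rightarrow> 'r set" where
  "tau_MCM \<tau> R = {r \<in> carrier R. \<forall>M :: 'r univ_module. MCM R M \<longrightarrow> r \<in> \<tau> R M}"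


section \<open>The ring \<open>k[[x,y,z]]/(x\<^sup>2 + z\<^sup>2)\<close>\<close>

text \<open>
  \<open>k[[x,y,z]]\<close> is the iterated power series ring \<open>k[[x]][[y]][[z]]\<close>; the coefficient of
  \<open>x^a y^b z^c\<close> in \<open>f\<close> is \<open>fps_nth (fps_nth (fps_nth f c) b) a\<close>.
\<close>

definition var_x :: "'k::field fps fps fps" where
  "var_x = fps_const (fps_const fps_X)"

definition var_z :: "'k::field fps fps fps" where
  "var_z = fps_X"

definition hypersurface :: "'k::field fps fps fps set ring" where
  "hypersurface = ring_of_type_algebra Quot (Idl\<^bsub>ring_of_type_algebra\<^esub> {var_x ^ 2 + var_z ^ 2})"

end

theory Submission
  imports Defs
begin

text \<open>
  Fix \<open>j\<close> with \<open>j\<^sup>2 = -1\<close>.  Then \<open>x\<^sup>2 + z\<^sup>2 = (z - j x) (z + j x)\<close>, and since \<open>2 \<noteq> 0\<close> the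
  two factors cut out two different smooth branches.  Substituting \<open>z = j x\<close> identifies
  \<open>M\<^sub>j = R/(z - j x)\<close> with \<open>k[[x,y]]\<close>, and both modules \<open>M\<^sub>j\<close> and \<open>M\<^sub>-\<^sub>j\<close> are maximal
  Cohen-Macaulay.  These two modules already cut the intersection down to zero.

  The element \<open>u = z - j x\<close> kills \<open>M\<^sub>j\<close>.  Hence \<open>u\<close> kills the image of every homomorphism from
  \<open>M\<^sub>j\<close> to \<open>R\<close>; but \<open>u\<close> restricts to \<open>-2 j x \<noteq> 0\<close> on the branch \<open>z = -j x\<close>, whose
  coordinate ring is a domain, so the trace ideal of \<open>M\<^sub>j\<close> vanishes on that branch
  (\<open>trace_ideal_quotient_module\<close>).  For the test ideal, tensors \<open>m \<otimes> u b = u m \<otimes> b\<close> with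
  \<open>m\<close> in \<open>M\<^sub>j\<close> are zero, so the closure of \<open>0\<close> in any \<open>B\<close> contains \<open>u B\<close>; taking for \<open>B\<close> the
  coordinate ring of the branch \<open>z = -j x\<close> gives the same conclusion
  (\<open>test_ideal_quotient_module\<close>).  An element of \<open>R\<close> that vanishes on both branches is zero
  (\<open>eval_on_both_lines_eq_0\<close>).

  It remains to see that \<open>M\<^sub>j\<close> has depth \<open>2\<close> and \<open>R\<close> has dimension \<open>2\<close>.  The lower bounds are
  explicit.  Both upper bounds come from one identity in \<open>k[[x,y]]\<close>, in the style of the
  constructive description of Krull dimension by Coquand and Lombardi: for all \<open>x\<^sub>0, x\<^sub>1, x\<^sub>2\<close> there
  are exponents and coefficients with
  \<open>x\<^sub>0\<^sup>l (x\<^sub>1\<^sup>m (x\<^sub>2\<^sup>n (1 + c x\<^sub>2) + b x\<^sub>1) + a x\<^sub>0) = 0\<close>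
  (\<open>zero_in_boundary_monoid_fps_fps\<close>).  Suppose that \<open>K\<^sub>0 \<subseteq> K\<^sub>1 \<subseteq> K\<^sub>2 \<subseteq> K\<^sub>3\<close> are ideals and
  \<open>x\<^sub>i \<in> K\<^sub>i\<^sub>+\<^sub>1\<close> is a non-zerodivisor modulo \<open>K\<^sub>i\<close>.  Cancelling the powers one after the other
  turns the identity into \<open>1 \<in> K\<^sub>3\<close> (\<open>boundary_monoid_chain\<close>).  A regular sequence of length
  three and a strict chain of four primes both provide such data.
\<close>


section \<open>Iterated boundary monoids\<close>

text \<open>
  For \<open>[x\<^sub>0, \<dots>, x\<^sub>n]\<close> these are the iterated boundary monoids of Coquand and Lombardi: a commutative
  ring has Krull dimension at most \<open>n\<close> if and only if \<open>0\<close> lies in the boundary monoid of every list of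
  \<open>n + 1\<close> elements.
\<close>

fun boundary_monoid :: "'a::comm_ring_1 list \<Rightarrow> 'a set" where
  "boundary_monoid [] = {1}"
| "boundary_monoid (x # xs) = {x ^ m * (w + a * x) | m a w. w \<in> boundary_monoid xs}"

lemma one_in_boundary_monoid: "1 \<in> boundary_monoid xs"
proof (induction xs)
  case (Cons x xs)
  have "1 = x ^ 0 * (1 + 0 * x)" by simp
  with Cons show ?case unfolding boundary_monoid.simps by blast
qed simp

text \<open>
  Closure under products allows the factors of \<open>x\<^sub>0\<close> to be treated one at a time below: elements of
  the monoid divisible by the single factors multiply to one that is divisible by \<open>x\<^sub>0\<close>.
\<close>

lemma boundary_monoid_mult:
  "v \<in> boundary_monoid xs \<Longrightarrow> w \<in> boundary_monoid xs \<Longrightarrow> v * w \<in> boundary_monoid xs"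
proof (induction xs arbitrary: v w)
  case (Cons x xs)
  from Cons.prems obtain m a v' n b w'
    where v: "v = x ^ m * (v' + a * x)" "v' \<in> boundary_monoid xs"
      and w: "w = x ^ n * (w' + b * x)" "w' \<in> boundary_monoid xs"
    by auto
  have "v * w = x ^ (m + n) * (v' * w' + (v' * b + a * w' + a * b * x) * x)"
    unfolding v w by (simp add: power_add algebra_simps)
  moreover have "v' * w' \<in> boundary_monoid xs"
    using Cons.IH v w by blast
  ultimately show ?case
    unfolding boundary_monoid.simps by blast
qed simp

lemma boundary_monoid_power: "w \<in> boundary_monoid xs \<Longrightarrow> w ^ n \<in> boundary_monoid xs"
  by (induction n) (auto simp: one_in_boundary_monoid boundary_monoid_mult)

lemma zero_in_boundary_monoid_ConsI:
  assumes "w \<in> boundary_monoid xs" "x dvd w"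
  shows "0 \<in> boundary_monoid (x # xs)"
proof -
  from assms obtain c where "w = x * c" by (elim dvdE)
  then have "0 = x ^ 0 * (w + (- c) * x)" by simp
  then show ?thesis
    unfolding boundary_monoid.simps using assms(1) by blast
qed

lemma zero_in_boundary_monoid_0: "0 \<in> boundary_monoid (0 # xs)"
proof -
  have "(0::'a) = 0 ^ 1 * (1 + 0 * 0)" by simp
  then show ?thesis
    unfolding boundary_monoid.simps using one_in_boundary_monoid by blast
qed

lemma power_in_boundary_monoid: "x ^ m \<in> boundary_monoid [x]"
proof -
  have "x ^ m = x ^ m * (1 + 0 * x)" by simp
  then show ?thesis by (simp only: boundary_monoid.simps) blast
qed

text \<open>
  The ideals of a ring given by a type are the submodules of the ring over itself.
\<close>

interpretation type_ideal: Modules.module "(*) :: 'a::comm_ring_1 \<Rightarrow> 'a \<Rightarrow> 'a"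
  by unfold_locales (auto simp: algebra_simps)

text \<open>
  For a ring acting on itself this rule is associativity of multiplication read backwards, which makes
  the simplifier loop together with \<open>mult.assoc\<close>.
\<close>

declare type_ideal.scale_scale [simp del]

text \<open>
  Remove the first element: \<open>x\<^sub>0\<^sup>m (v + a x\<^sub>0) \<in> K\<^sub>0\<close> gives \<open>v + a x\<^sub>0 \<in> K\<^sub>0 \<subseteq> K\<^sub>1\<close>, because \<open>x\<^sub>0\<close> is a
  non-zerodivisor modulo \<open>K\<^sub>0\<close>, and then \<open>v \<in> K\<^sub>1\<close>, because \<open>x\<^sub>0 \<in> K\<^sub>1\<close>.  Now \<open>v\<close> belongs to the
  shorter list.
\<close>

lemma boundary_monoid_chain:
  fixes K :: "nat \<Rightarrow> 'a::comm_ring_1 set"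
  assumes "\<And>i. i \<le> length xs \<Longrightarrow> type_ideal.subspace (K i)"
    and "\<And>i. i < length xs \<Longrightarrow> K i \<subseteq> K (Suc i)"
    and "\<And>i. i < length xs \<Longrightarrow> xs ! i \<in> K (Suc i)"
    and "\<And>i b. i < length xs \<Longrightarrow> xs ! i * b \<in> K i \<Longrightarrow> b \<in> K i"
    and "w \<in> boundary_monoid xs" "w \<in> K 0"
  shows "1 \<in> K (length xs)"
  using assms
proof (induction xs arbitrary: K w)
  case (Cons x xs)
  from Cons.prems(5) obtain m a v
    where w: "w = x ^ m * (v + a * x)" and v: "v \<in> boundary_monoid xs"
    unfolding boundary_monoid.simps by blast
  have cancel: "b \<in> K 0" if "x ^ n * b \<in> K 0" for n b
    using that
  proof (induction n)
    case (Suc n)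
    then show ?case using Cons.prems(4)[of 0 "x ^ n * b"] by (simp add: mult.assoc)
  qed simp
  have "v + a * x \<in> K 0"
    using Cons.prems(6) cancel unfolding w by blast
  then have "v + a * x \<in> K 1" using Cons.prems(2)[of 0] by auto
  moreover have "a * x \<in> K 1"
    using Cons.prems(1)[of 1] Cons.prems(3)[of 0] by (simp add: type_ideal.subspace_scale)
  ultimately have "v + a * x - a * x \<in> K 1"
    using Cons.prems(1)[of 1] by (intro type_ideal.subspace_diff) auto
  then have "v \<in> (K \<circ> Suc) 0" by simp
  have "1 \<in> (K \<circ> Suc) (length xs)"
  proof (rule Cons.IH)
    show "v \<in> (K \<circ> Suc) 0" by fact
    show "v \<in> boundary_monoid xs" by fact
  next
    fix i assume "i \<le> length xs"
    then show "type_ideal.subspace ((K \<circ> Suc) i)" using Cons.prems(1)[of "Suc i"] by simp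
  next
    fix i assume i: "i < length xs"
    show "(K \<circ> Suc) i \<subseteq> (K \<circ> Suc) (Suc i)" using Cons.prems(2)[of "Suc i"] i by simp
    show "xs ! i \<in> (K \<circ> Suc) (Suc i)" using Cons.prems(3)[of "Suc i"] i by simp
    show "b \<in> (K \<circ> Suc) i" if "xs ! i * b \<in> (K \<circ> Suc) i" for b
      using Cons.prems(4)[of "Suc i"] i that by simp
  qed
  then show ?case by simp
qed simp

section \<open>Power series in two variables have dimension at most two\<close>

text \<open>
  More vectors than coordinates are dependent, also over a domain: eliminate the coordinate \<open>k\<close> with a
  pivot vector \<open>p\<close> and cross-multiply instead of dividing.
\<close>

lemma linear_dependence:
  fixes v :: "'i \<Rightarrow> 'j \<Rightarrow> 'a::idom"
  assumes "finite J" "finite I" "card J < card I"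
  shows "\<exists>c. (\<exists>i\<in>I. c i \<noteq> 0) \<and> (\<forall>j\<in>J. (\<Sum>i\<in>I. c i * v i j) = 0)"
  using assms
proof (induction J arbitrary: I v rule: finite_induct)
  case empty
  then obtain i where "i \<in> I" by fastforce
  then show ?case by (intro exI[of _ "\<lambda>_. 1"]) auto
next
  case (insert k J)
  show ?case
  proof (cases "\<exists>p\<in>I. v p k \<noteq> 0")
    case False
    have "card J < card I" using insert by simp
    then obtain c where "\<exists>i\<in>I. c i \<noteq> 0" "\<forall>j\<in>J. (\<Sum>i\<in>I. c i * v i j) = 0"
      using insert.IH[of I v] insert.prems by blast
    moreover have "(\<Sum>i\<in>I. c i * v i k) = 0"
      using False by (intro sum.neutral) auto
    ultimately show ?thesis by blast
  next
    case True
    then obtain p where p: "p \<in> I" "v p k \<noteq> 0" by blast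
    define w where "w i j = v p k * v i j - v i k * v p j" for i j
    have "card J < card (I - {p})" using insert p by simp
    then obtain c where c: "\<exists>i\<in>I - {p}. c i \<noteq> 0" "\<forall>j\<in>J. (\<Sum>i\<in>I - {p}. c i * w i j) = 0"
      using insert.IH[of "I - {p}" w] insert.prems by blast
    define c' where "c' i = (if i = p then - (\<Sum>i\<in>I - {p}. c i * v i k) else c i * v p k)" for i
    have *: "(\<Sum>i\<in>I. c' i * v i j) = (\<Sum>i\<in>I - {p}. c i * w i j)" for j
    proof -
      have "(\<Sum>i\<in>I. c' i * v i j) = c' p * v p j + (\<Sum>i\<in>I - {p}. c' i * v i j)"
        using insert.prems p by (simp add: sum.remove)
      also have "(\<Sum>i\<in>I - {p}. c' i * v i j) = (\<Sum>i\<in>I - {p}. c i * v p k * v i j)"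
        by (intro sum.cong) (auto simp: c'_def)
      also have "c' p * v p j = - (\<Sum>i\<in>I - {p}. c i * v i k * v p j)"
        by (simp add: c'_def sum_distrib_right)
      finally show ?thesis
        by (simp add: w_def right_diff_distrib sum_subtractf mult.assoc)
    qed
    have "(\<Sum>i\<in>I. c' i * v i j) = 0" if "j \<in> insert k J" for j
    proof (cases "j = k")
      case True
      then show ?thesis unfolding * by (simp add: w_def)
    next
      case False
      then show ?thesis using that c(2) unfolding * by auto
    qed
    moreover have "\<exists>i\<in>I. c' i \<noteq> 0"
      using c(1) p(2) by (auto simp: c'_def)
    ultimately show ?thesis by blast
  qed
qed

text \<open>
  The coefficients of the quotient in the outer variable \<open>t\<close>, found one after the other.  If
  \<open>a \<equiv> s\<^sup>d v\<close> modulo \<open>t\<close> with a unit \<open>v\<close>, then the next coefficient is determined by the requirement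
  that it removes all terms of degree at least \<open>d\<close> in the inner variable \<open>s\<close>.
\<close>

fun weierstrass_quotient :: "'k::field fps fps \<Rightarrow> 'k fps fps \<Rightarrow> nat \<Rightarrow> 'k fps" where
  "weierstrass_quotient a f n =
     fps_shift (subdegree (a $ 0)) (f $ n - (\<Sum>i<n. weierstrass_quotient a f i * a $ (n - i))) *
     inverse (fps_shift (subdegree (a $ 0)) (a $ 0))"

declare weierstrass_quotient.simps [simp del]

lemma weierstrass_division:
  fixes a f :: "'k::field fps fps"
  assumes "a $ 0 \<noteq> 0"
  obtains q r where "f = a * q + r" "\<And>n m. subdegree (a $ 0) \<le> m \<Longrightarrow> r $ n $ m = 0"
proof -
  define d where "d = subdegree (a $ 0)"
  define u where "u = fps_shift d (a $ 0)"
  define q where "q = Abs_fps (weierstrass_quotient a f)"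
  have u: "u * inverse u = 1"
    using assms by (simp add: u_def d_def inverse_mult_eq_1')
  have a0: "a $ 0 = u * fps_X ^ d"
    unfolding u_def d_def by (rule subdegree_decompose)
  have "(f - a * q) $ n $ m = 0" if "d \<le> m" for n m
  proof -
    define g where "g = f $ n - (\<Sum>i<n. weierstrass_quotient a f i * a $ (n - i))"
    have qn: "q $ n = fps_shift d g * inverse u"
      unfolding q_def fps_nth_Abs_fps
      by (subst weierstrass_quotient.simps) (simp add: g_def d_def u_def)
    have "(a * q) $ n = (\<Sum>i=0..n. q $ i * a $ (n - i))"
      by (subst mult.commute) (rule fps_mult_nth)
    also have "{0..n} = insert n {..<n}" by auto
    also have "(\<Sum>i\<in>insert n {..<n}. q $ i * a $ (n - i)) =
        q $ n * a $ 0 + (\<Sum>i<n. weierstrass_quotient a f i * a $ (n - i))"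
      by (simp add: q_def)
    finally have "(f - a * q) $ n = g - q $ n * a $ 0"
      by (simp add: g_def)
    also have "q $ n * a $ 0 = fps_shift d g * fps_X ^ d * (u * inverse u)"
      unfolding qn a0 by (simp only: ac_simps)
    finally have "(f - a * q) $ n = g - fps_shift d g * fps_X ^ d"
      using u by simp
    then show ?thesis using that by (simp add: fps_X_power_mult_right_nth)
  qed
  then show thesis
    by (intro that[of q "f - a * q"]) (auto simp: d_def)
qed

text \<open>
  \<open>k[[s]][[t]]\<close> is an algebra over \<open>k[[t]]\<close>, but \<open>fps_const\<close> embeds the coefficient ring \<open>k[[s]]\<close>.
  \<open>fps_of_outer\<close> is the embedding of \<open>k[[t]]\<close>, and \<open>fps_column m\<close> is the \<open>k[[t]]\<close>-linear coefficient
  of \<open>s\<^sup>m\<close>.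
\<close>

definition fps_of_outer :: "'k::field fps \<Rightarrow> 'k fps fps" where
  "fps_of_outer c = Abs_fps (\<lambda>n. fps_const (c $ n))"

definition fps_column :: "nat \<Rightarrow> 'k::field fps fps \<Rightarrow> 'k fps" where
  "fps_column m f = Abs_fps (\<lambda>n. f $ n $ m)"

lemma fps_of_outer_mult: "fps_of_outer (c * d) = fps_of_outer c * fps_of_outer d"
  by (intro fps_ext) (simp add: fps_of_outer_def fps_mult_nth fps_sum_nth sum_distrib_left)

lemma fps_column_mult: "fps_column m (fps_of_outer c * f) = c * fps_column m f"
  by (intro fps_ext)
    (simp add: fps_of_outer_def fps_column_def fps_mult_nth[of "Abs_fps _"] fps_mult_nth[of c] fps_sum_nth)

lemma fps_column_sum: "fps_column m (sum f I) = (\<Sum>i\<in>I. fps_column m (f i))"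
  by (intro fps_ext) (simp add: fps_column_def fps_sum_nth)

lemma fps_eq_0_if_columns: "(\<And>m. fps_column m f = 0) \<Longrightarrow> f = 0"
  by (intro fps_ext) (metis fps_column_def fps_nth_Abs_fps fps_zero_nth)

text \<open>
  By Weierstrass division \<open>k[[s]][[t]]/(a)\<close> is spanned by \<open>d\<close> elements over \<open>k[[t]]\<close>, so the \<open>d + 1\<close>
  powers \<open>1, b, \<dots>, b\<^sup>d\<close> satisfy a nontrivial relation.  Its lowest nonzero coefficient is a unit times
  a power of \<open>t\<close>.
\<close>

lemma algebraic_relation:
  fixes a b :: "'k::field fps fps"
  assumes "a $ 0 \<noteq> 0"
  obtains i N g where "a dvd b ^ i * (fps_X ^ N + b * g)"
proof -
  define d where "d = subdegree (a $ 0)"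
  have "\<exists>q r. b ^ i = a * q + r \<and> (\<forall>n m. d \<le> m \<longrightarrow> r $ n $ m = 0)" for i
    using weierstrass_division[OF assms, of "b ^ i"] unfolding d_def by metis
  then obtain q r where r: "\<And>i. b ^ i = a * q i + r i"
    and r0: "\<And>i n m. d \<le> m \<Longrightarrow> r i $ n $ m = 0"
    by metis
  obtain c where c: "\<exists>i\<in>{..d}. c i \<noteq> 0"
      "\<forall>m\<in>{..<d}. (\<Sum>i\<in>{..d}. c i * fps_column m (r i)) = 0"
    using linear_dependence[of "{..<d}" "{..d}" "\<lambda>i m. fps_column m (r i)"] by auto
  have "(\<Sum>i\<le>d. fps_of_outer (c i) * r i) = 0"
  proof (rule fps_eq_0_if_columns)
    fix m
    show "fps_column m (\<Sum>i\<le>d. fps_of_outer (c i) * r i) = 0"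
    proof (cases "m < d")
      case True
      then show ?thesis using c(2) by (simp add: fps_column_sum fps_column_mult)
    next
      case False
      then have "fps_column m (r i) = 0" for i
        using r0 by (intro fps_ext) (simp add: fps_column_def)
      then show ?thesis by (simp add: fps_column_sum fps_column_mult)
    qed
  qed
  then have "(\<Sum>i\<le>d. fps_of_outer (c i) * b ^ i) = a * (\<Sum>i\<le>d. fps_of_outer (c i) * q i)"
    by (simp add: r distrib_left sum.distrib sum_distrib_left mult_ac)
  then have dvd: "a dvd (\<Sum>i\<le>d. fps_of_outer (c i) * b ^ i)" by simp
  define i where "i = (LEAST i. c i \<noteq> 0)"
  have ci: "c i \<noteq> 0" and less: "\<And>l. l < i \<Longrightarrow> c l = 0"
    using c(1) LeastI[of "\<lambda>i. c i \<noteq> 0"] not_less_Least[of _ "\<lambda>i. c i \<noteq> 0"]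
    unfolding i_def by blast+
  have "i \<le> d"
    using c(1) less by (meson atMost_iff le_trans not_le_imp_less)
  define N where "N = subdegree (c i)"
  define w where "w = fps_shift N (c i)"
  have w: "w * inverse w = 1"
    using ci by (simp add: w_def N_def inverse_mult_eq_1')
  have outer_X: "fps_of_outer (fps_X ^ N) = (fps_X ^ N :: 'k fps fps)"
    by (intro fps_ext) (simp add: fps_of_outer_def)
  have outer_0: "fps_of_outer 0 = (0 :: 'k fps fps)"
    by (intro fps_ext) (simp add: fps_of_outer_def)
  have "c i = w * fps_X ^ N"
    unfolding w_def N_def by (rule subdegree_decompose)
  then have "c i * inverse w = fps_X ^ N * (w * inverse w)"
    by (simp only: ac_simps)
  then have lead: "fps_of_outer (c i) * fps_of_outer (inverse w) = fps_X ^ N"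
    unfolding fps_of_outer_mult[symmetric] w by (simp add: outer_X)
  define g where "g = (\<Sum>l=Suc i..d. fps_of_outer (c l) * b ^ (l - Suc i)) * fps_of_outer (inverse w)"
  have "(\<Sum>l\<le>d. fps_of_outer (c l) * b ^ l) = (\<Sum>l=i..d. fps_of_outer (c l) * b ^ l)"
    using less by (intro sum.mono_neutral_right) (auto simp: outer_0 not_le)
  also have "\<dots> = fps_of_outer (c i) * b ^ i + (\<Sum>l=Suc i..d. fps_of_outer (c l) * b ^ l)"
    using \<open>i \<le> d\<close> by (rule sum.atLeast_Suc_atMost)
  also have "(\<Sum>l=Suc i..d. fps_of_outer (c l) * b ^ l) =
      b ^ i * (b * (\<Sum>l=Suc i..d. fps_of_outer (c l) * b ^ (l - Suc i)))"
    unfolding sum_distrib_left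
  proof (intro sum.cong refl)
    fix l assume "l \<in> {Suc i..d}"
    then have "l = i + Suc (l - Suc i)" by simp
    then have "b ^ l = b ^ i * (b * b ^ (l - Suc i))"
      by (metis power_Suc power_add)
    then show "fps_of_outer (c l) * b ^ l = b ^ i * (b * (fps_of_outer (c l) * b ^ (l - Suc i)))"
      by (simp add: ac_simps)
  qed
  finally have "(\<Sum>l\<le>d. fps_of_outer (c l) * b ^ l) * fps_of_outer (inverse w) =
      b ^ i * (fps_of_outer (c i) * fps_of_outer (inverse w) + b * g)"
    unfolding g_def by (simp only: distrib_left distrib_right mult_ac)
  then have "a dvd b ^ i * (fps_X ^ N + b * g)"
    unfolding lead using dvd_mult2[OF dvd, of "fps_of_outer (inverse w)"] by simp
  then show thesis by (rule that)
qed

lemma fps_X_dvd_iff: "fps_X dvd f \<longleftrightarrow> f $ 0 = (0 :: 'a::comm_ring_1)"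
proof
  assume "f $ 0 = 0"
  then have "f = fps_X * fps_shift 1 f"
    by (intro fps_ext) (simp add: fps_X_mult_nth)
  then show "fps_X dvd f" by (metis dvd_triv_left)
qed auto

text \<open>
  If \<open>a\<close> is not divisible by \<open>t\<close>, then the ideal \<open>(a, t\<^sup>N)\<close> contains a power of the maximal ideal.  Modulo \<open>t\<close> a
  power of \<open>x\<close> is a multiple of \<open>a\<close>, since \<open>k[[s]]\<close> is a valuation ring; raise this to the power \<open>N\<close>.
\<close>

lemma power_in_pair:
  fixes a x :: "'k::field fps fps"
  assumes "a $ 0 \<noteq> 0" "x $ 0 $ 0 = 0"
  obtains m \<alpha> \<beta> where "x ^ m = a * \<alpha> + fps_X ^ N * \<beta>"
proof -
  define d where "d = subdegree (a $ 0)"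
  have "fps_X dvd x $ 0" using assms(2) by (simp add: fps_X_dvd_iff)
  then have "fps_X ^ d dvd (x ^ d) $ 0"
    by (simp add: fps_nth_power_0 dvd_power_same)
  moreover have "a $ 0 dvd fps_X ^ d"
    using assms(1) by (simp add: fps_dvd_iff d_def)
  ultimately obtain h where h: "(x ^ d) $ 0 = a $ 0 * h"
    by (meson dvd_trans dvdE)
  have "fps_X dvd x ^ d - a * fps_const h"
    unfolding fps_X_dvd_iff using h by simp
  then obtain \<gamma> where \<gamma>: "x ^ d - a * fps_const h = fps_X * \<gamma>" by (elim dvdE)
  have "a dvd x ^ d - fps_X * \<gamma>" unfolding \<gamma>[symmetric] by simp
  moreover have "x ^ d - fps_X * \<gamma> dvd (x ^ d) ^ N - (fps_X * \<gamma>) ^ N"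
    by (simp add: power_diff_sumr2)
  ultimately obtain \<alpha> where "(x ^ d) ^ N - (fps_X * \<gamma>) ^ N = a * \<alpha>"
    by (meson dvd_trans dvdE)
  then have "x ^ (d * N) = a * \<alpha> + fps_X ^ N * \<gamma> ^ N"
    unfolding power_mult power_mult_distrib by (simp add: algebra_simps)
  then show thesis by (rule that)
qed

text \<open>
  The claim is immediate if \<open>x\<^sub>0 = 0\<close> or \<open>x\<^sub>2\<close> is a unit.  Otherwise write \<open>x\<^sub>0 = a t\<^sup>e\<close> with \<open>a\<close> not divisible
  by \<open>t\<close>.  Modulo \<open>a\<close>, and likewise modulo \<open>t\<close>, the ring has dimension at most one, so that each of these two
  factors divides an element of the boundary monoid of \<open>[x\<^sub>1, x\<^sub>2]\<close>.
\<close>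

proposition zero_in_boundary_monoid_fps_fps:
  fixes x0 x1 x2 :: "'k::field fps fps"
  shows "0 \<in> boundary_monoid [x0, x1, x2]"
proof -
  consider "x0 = 0" | "x2 $ 0 $ 0 \<noteq> 0" | "x0 \<noteq> 0" "x2 $ 0 $ 0 = 0" by blast
  then show ?thesis
  proof cases
    case 1
    then show ?thesis by (simp only: zero_in_boundary_monoid_0)
  next
    case 2
    then have "x2 $ 0 \<noteq> 0" by auto
    then obtain q r where qr: "1 = x2 * q + r"
        "\<And>n m. subdegree (x2 $ 0) \<le> m \<Longrightarrow> r $ n $ m = 0"
      using weierstrass_division[of x2 1] by blast
    \<comment> \<open>Division by a series of order zero leaves no remainder, so it has an inverse.\<close>
    have "subdegree (x2 $ 0) = 0" using 2 by simp
    with qr(2) have "r = 0" by (intro fps_ext) simp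
    with qr(1) have "x2 dvd 1" by (metis add_0_right dvdI)
    then have "0 \<in> boundary_monoid [x2]"
      by (intro zero_in_boundary_monoid_ConsI[of 1]) simp_all
    then have "0 \<in> boundary_monoid [x1, x2]"
      by (rule zero_in_boundary_monoid_ConsI) simp
    then show ?thesis
      by (rule zero_in_boundary_monoid_ConsI) simp
  next
    case 3
    define e where "e = subdegree x0"
    define a where "a = fps_shift e x0"
    have x0: "x0 = a * fps_X ^ e"
      unfolding a_def e_def by (rule subdegree_decompose)
    have a0: "a $ 0 \<noteq> 0" using 3 by (simp add: a_def e_def)
    have "\<exists>w\<in>boundary_monoid [x1, x2]. a dvd w"
    proof -
      obtain i N g where dvd: "a dvd x1 ^ i * (fps_X ^ N + x1 * g)"
        using algebraic_relation[OF a0] by metis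
      obtain m \<alpha> \<beta> where m: "x2 ^ m = a * \<alpha> + fps_X ^ N * \<beta>"
        using power_in_pair[OF a0 3(2)] by metis
      have "x1 ^ i * (x2 ^ m + g * \<beta> * x1) =
          x1 ^ i * (fps_X ^ N + x1 * g) * \<beta> + a * (\<alpha> * x1 ^ i)"
        unfolding m by (simp add: algebra_simps)
      then have "a dvd x1 ^ i * (x2 ^ m + g * \<beta> * x1)"
        using dvd by simp
      moreover have "x1 ^ i * (x2 ^ m + g * \<beta> * x1) \<in> boundary_monoid [x1, x2]"
        using power_in_boundary_monoid unfolding boundary_monoid.simps(2)[of x1] by blast
      ultimately show ?thesis by blast
    qed
    then obtain v where v: "v \<in> boundary_monoid [x1, x2]" "a dvd v" by blast
    have "\<exists>w\<in>boundary_monoid [x1, x2]. fps_X dvd w"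
    proof (cases "x1 $ 0 = 0")
      case True
      then have "fps_X dvd x1 ^ 1 * (1 + 0 * x1)" by (simp add: fps_X_dvd_iff)
      moreover have "x1 ^ 1 * (1 + 0 * x1) \<in> boundary_monoid [x1, x2]"
        using one_in_boundary_monoid unfolding boundary_monoid.simps(2)[of x1] by blast
      ultimately show ?thesis by blast
    next
      case False
      then obtain m \<alpha> \<beta> where m: "x2 ^ m = x1 * \<alpha> + fps_X ^ 1 * \<beta>"
        using power_in_pair 3(2) by metis
      have "fps_X dvd x1 ^ 0 * (x2 ^ m + (- \<alpha>) * x1)"
        unfolding m by simp
      moreover have "x1 ^ 0 * (x2 ^ m + (- \<alpha>) * x1) \<in> boundary_monoid [x1, x2]"
        using power_in_boundary_monoid unfolding boundary_monoid.simps(2)[of x1] by blast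
      ultimately show ?thesis by blast
    qed
    then obtain w where w: "w \<in> boundary_monoid [x1, x2]" "fps_X dvd w" by blast
    have "v * w ^ e \<in> boundary_monoid [x1, x2]"
      by (intro boundary_monoid_mult boundary_monoid_power v w)
    moreover have "x0 dvd v * w ^ e"
      unfolding x0 by (intro mult_dvd_mono v dvd_power_same w)
    ultimately show ?thesis by (rule zero_in_boundary_monoid_ConsI)
  qed
qed

section \<open>The module of a surjection onto a domain\<close>

locale surjection_onto_domain = R?: cring R for R :: "'r ring" (structure) +
  fixes e :: "'r \<Rightarrow> 'b::idom"
  assumes hom: "e \<in> ring_hom R ring_of_type_algebra"
    and surj: "e ` carrier R = UNIV"
begin

lemma e_add [simp]: "a \<in> carrier R \<Longrightarrow> b \<in> carrier R \<Longrightarrow> e (a \<oplus> b) = e a + e b"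
  using ring_hom_add[OF hom] by (simp add: ring_of_type_algebra_def)

lemma e_mult [simp]: "a \<in> carrier R \<Longrightarrow> b \<in> carrier R \<Longrightarrow> e (a \<otimes> b) = e a * e b"
  using ring_hom_mult[OF hom] by (simp add: ring_of_type_algebra_def)

lemma e_one [simp]: "e \<one> = 1"
  using ring_hom_one[OF hom] by (simp add: ring_of_type_algebra_def)

lemma e_zero [simp]: "e \<zero> = 0"
  by (metis R.l_zero R.zero_closed add_cancel_right_right e_add)

lemma e_minus [simp]: "a \<in> carrier R \<Longrightarrow> e (\<ominus> a) = - e a"
  using e_add[of a "\<ominus> a"] by (simp add: R.r_neg eq_neg_iff_add_eq_0 add.commute)

lemma preimage: obtains r where "r \<in> carrier R" "e r = b"
  using surj by (metis UNIV_I imageE)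

text \<open>
  The module \<open>R/ker e\<close>, realised by cosets in \<open>R\<^sup>1\<close>: the fibre of \<open>e\<close> over \<open>b\<close>, with a ring element
  \<open>r\<close> embedded as a constant sequence.
\<close>

definition enc :: "'b \<Rightarrow> (nat \<Rightarrow> 'r) set" where
  "enc b = {\<lambda>_. r | r. r \<in> carrier R \<and> e r = b}"

lemma inj_enc: "inj enc"
proof (rule injI)
  fix a b assume ab: "enc a = enc b"
  obtain r where "r \<in> carrier R" "e r = a" by (rule preimage)
  then have "(\<lambda>_. r) \<in> enc a"
    unfolding enc_def by (intro CollectI exI[of _ r]) simp
  then have "(\<lambda>_. r) \<in> enc b" by (simp only: ab)
  then obtain r' where r': "(\<lambda>_. r) = (\<lambda>_ :: nat. r')" "e r' = b"
    unfolding enc_def by (elim CollectE exE conjE)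
  have "r = r'" using r'(1) by (rule fun_cong)
  then show "a = b" using \<open>e r = a\<close> r'(2) by simp
qed

lemma enc_eq_iff [simp]: "enc a = enc b \<longleftrightarrow> a = b"
  using inj_enc by (simp add: inj_eq)

lemma the_inv_enc [simp]: "the_inv enc (enc b) = b"
  using inj_enc by (rule the_inv_f_f)

text \<open>
  The structure is that of the ring \<open>'b\<close>, transported along \<open>enc\<close>, with \<open>R\<close> acting through \<open>e\<close>.
\<close>

definition quotient_module :: "'r univ_module" where
  "quotient_module = \<lparr>carrier = range enc,
     monoid.mult = (\<lambda>m n. enc (the_inv enc m * the_inv enc n)), monoid.one = enc 1, ring.zero = enc 0,
     ring.add = (\<lambda>m n. enc (the_inv enc m + the_inv enc n)), module.smult = (\<lambda>r m. enc (e r * the_inv enc m))\<rparr>"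

abbreviation M where "M \<equiv> quotient_module"

lemma quotient_module_simps [simp]:
  "carrier M = range enc"
  "enc a \<oplus>\<^bsub>M\<^esub> enc b = enc (a + b)"
  "\<zero>\<^bsub>M\<^esub> = enc 0"
  "r \<odot>\<^bsub>M\<^esub> enc b = enc (e r * b)"
  by (simp_all add: quotient_module_def)

lemma module_quotient_module: "Module.module R M"
proof (rule moduleI)
  show "abelian_group M"
  proof (rule abelian_groupI)
    fix x assume "x \<in> carrier M"
    then obtain b where "x = enc b" by auto
    then have "enc (- b) \<oplus>\<^bsub>M\<^esub> x = \<zero>\<^bsub>M\<^esub>" by simp
    then show "\<exists>y\<in>carrier M. y \<oplus>\<^bsub>M\<^esub> x = \<zero>\<^bsub>M\<^esub>" by auto
  qed (auto simp: add_ac)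
qed (auto simp: R.is_cring algebra_simps)

interpretation M: Module.module R M by (rule module_quotient_module)

lemma M_minus [simp]: "\<ominus>\<^bsub>M\<^esub> enc b = enc (- b)"
  by (rule M.M.minus_equality) auto

lemma submodule_enc_image:
  assumes "type_ideal.subspace J"
  shows "submodule (enc ` J) R M"
  by (rule M.submoduleI)
    (use assms in \<open>auto simp: type_ideal.subspace_0 type_ideal.subspace_add
        type_ideal.subspace_scale type_ideal.subspace_neg\<close>)

lemma submodule_vimage_enc:
  assumes "submodule N R M"
  shows "type_ideal.subspace (enc -` N)"
proof (rule type_ideal.subspaceI)
  note N = M.submoduleE[OF assms]
  interpret N: submodule N R M by (rule assms)
  show "0 \<in> enc -` N" using N.one_closed by simp
  show "x + y \<in> enc -` N" if "x \<in> enc -` N" "y \<in> enc -` N" for x y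
    using N(5)[of "enc x" "enc y"] that by simp
  show "c * x \<in> enc -` N" if "x \<in> enc -` N" for c x
  proof -
    obtain r where "r \<in> carrier R" "e r = c" by (rule preimage)
    then show ?thesis using N(4)[of r "enc x"] that by simp
  qed
qed

lemma ideal_vimage:
  assumes "type_ideal.subspace J"
  shows "ideal {r \<in> carrier R. e r \<in> J} R"
proof (rule idealI)
  show "ring R" by (rule R.ring_axioms)
  show "subgroup {r \<in> carrier R. e r \<in> J} (add_monoid R)"
  proof (rule R.add.subgroupI)
    show "{r \<in> carrier R. e r \<in> J} \<noteq> {}"
      using type_ideal.subspace_0[OF assms] e_zero R.zero_closed by force
    show "\<ominus> a \<in> {r \<in> carrier R. e r \<in> J}"
      if "a \<in> {r \<in> carrier R. e r \<in> J}" for a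
      using that type_ideal.subspace_neg[OF assms] by simp
  qed (simp_all add: type_ideal.subspace_add[OF assms])
  fix a x assume a: "a \<in> {r \<in> carrier R. e r \<in> J}" and x: "x \<in> carrier R"
  then have "e x * e a \<in> J" by (intro type_ideal.subspace_scale[OF assms]) simp
  then show "x \<otimes> a \<in> {r \<in> carrier R. e r \<in> J}" "a \<otimes> x \<in> {r \<in> carrier R. e r \<in> J}"
    using a x by (simp_all add: mult.commute)
qed

text \<open>
  Submodules of \<open>M\<close> are ideals of \<open>'b\<close>, so that regular sequences on \<open>M\<close> can be studied in the ring
  \<open>'b\<close>.
\<close>

lemma ideal_smult_quotient_module:
  assumes "S \<subseteq> carrier R"
  shows "ideal_smult R (Idl S) M = enc ` type_ideal.span (e ` S)"
proof
  let ?J = "type_ideal.span (e ` S)"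
  have "S \<subseteq> {r \<in> carrier R. e r \<in> ?J}"
    using assms by (auto intro: type_ideal.span_base)
  then have "Idl S \<subseteq> {r \<in> carrier R. e r \<in> ?J}"
    by (intro R.genideal_minimal ideal_vimage type_ideal.subspace_span)
  then have "{a \<odot>\<^bsub>M\<^esub> m | a m. a \<in> Idl S \<and> m \<in> carrier M} \<subseteq> enc ` ?J"
    by (auto simp: mult.commute[of "e _"] intro!: imageI type_ideal.span_scale)
  then show "ideal_smult R (Idl S) M \<subseteq> enc ` ?J"
    unfolding ideal_smult_def span_module_def
    using submodule_enc_image[OF type_ideal.subspace_span] by blast
next
  show "enc ` type_ideal.span (e ` S) \<subseteq> ideal_smult R (Idl S) M"
    unfolding ideal_smult_def span_module_def
  proof (rule Inter_greatest)
    fix N assume "N \<in> {N. submodule N R M \<and> {a \<odot>\<^bsub>M\<^esub> m |a m. a \<in> Idl S \<and> m \<in> carrier M} \<subseteq> N}"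
    then have N: "submodule N R M" "\<And>a m. a \<in> Idl S \<Longrightarrow> m \<in> carrier M \<Longrightarrow> a \<odot>\<^bsub>M\<^esub> m \<in> N"
      by blast+
    have "e ` S \<subseteq> enc -` N"
    proof safe
      fix r assume "r \<in> S"
      then have "r \<in> Idl S" using R.genideal_self[OF assms] by blast
      then show "e r \<in> enc -` N" using N(2)[of r "enc 1"] by simp
    qed
    then have "type_ideal.span (e ` S) \<subseteq> enc -` N"
      by (intro type_ideal.span_minimal submodule_vimage_enc N)
    then show "enc ` type_ideal.span (e ` S) \<subseteq> N" by blast
  qed
qed

lemma regular_seq_quotient_module_iff:
  "regular_seq R M xs \<longleftrightarrow> set xs \<subseteq> carrier R \<and> 1 \<notin> type_ideal.span (e ` set xs) \<and>
     (\<forall>i<length xs. \<forall>b. e (xs ! i) * b \<in> type_ideal.span (e ` set (take i xs)) \<longrightarrow>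
        b \<in> type_ideal.span (e ` set (take i xs)))"
proof (cases "set xs \<subseteq> carrier R")
  case True
  have take: "set (take i xs) \<subseteq> carrier R" for i
    using True set_take_subset by fastforce
  have "enc ` J = range enc \<longleftrightarrow> 1 \<in> J" if J: "type_ideal.subspace J" for J
  proof
    assume "1 \<in> J"
    then have "c \<in> J" for c using type_ideal.subspace_scale[OF J, of 1 c] by simp
    then show "enc ` J = range enc" by auto
  qed (auto simp: inj_image_eq_iff[OF inj_enc])
  then have "enc ` type_ideal.span (e ` set xs) \<noteq> carrier M \<longleftrightarrow>
      1 \<notin> type_ideal.span (e ` set xs)"
    by simp
  moreover have "nonzerodivisor_mod M (enc ` J) r \<longleftrightarrow> (\<forall>b. e r * b \<in> J \<longrightarrow> b \<in> J)" for J r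
    unfolding nonzerodivisor_mod_def
    by (simp add: inj_image_mem_iff[OF inj_enc])
  ultimately show ?thesis
    using True unfolding regular_seq_def
    by (simp only: ideal_smult_quotient_module[OF True] ideal_smult_quotient_module[OF take])
next
  case False
  then show ?thesis by (simp add: regular_seq_def)
qed

lemma fin_gen_quotient_module: "fin_gen_module R M"
  unfolding fin_gen_module_def
proof (intro exI conjI)
  show "span_module R M {enc 1} = carrier M"
  proof
    have "submodule (carrier M) R M"
      using submodule_enc_image[of UNIV] by simp
    then show "span_module R M {enc 1} \<subseteq> carrier M"
      unfolding span_module_def by auto
    show "carrier M \<subseteq> span_module R M {enc 1}"
      unfolding span_module_def
    proof (rule Inter_greatest)
      fix N assume "N \<in> {N. submodule N R M \<and> {enc 1} \<subseteq> N}"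
      then have N: "type_ideal.subspace (enc -` N)" "1 \<in> enc -` N"
        using submodule_vimage_enc by auto
      then show "carrier M \<subseteq> N"
        using type_ideal.subspace_scale[OF N] by auto
    qed
  qed
qed auto

lemma primeideal_vimage:
  assumes "type_ideal.subspace J" "1 \<notin> J" "\<And>a b. a * b \<in> J \<Longrightarrow> a \<in> J \<or> b \<in> J"
  shows "primeideal {r \<in> carrier R. e r \<in> J} R"
proof (rule primeidealI)
  show "carrier R \<noteq> {r \<in> carrier R. e r \<in> J}"
    using assms(2) e_one R.one_closed by (metis (mono_tags, lifting) mem_Collect_eq)
qed (use assms ideal_vimage in \<open>auto simp: R.is_cring\<close>)

end

section \<open>Surjections onto power series in two variables\<close>

locale surjection_onto_fps_fps = surjection_onto_domain R e
  for R :: "'r ring" (structure) and e :: "'r \<Rightarrow> 'k::field fps fps"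
begin

text \<open>
  The ideals generated by the initial segments of a regular sequence form the chain required by
  \<open>boundary_monoid_chain\<close>.
\<close>

lemma length_regular_seq_le: 
  assumes "regular_seq R M xs"
  shows "length xs \<le> 2"
proof (rule ccontr)
  assume "\<not> length xs \<le> 2"
  then have len: "length xs \<ge> 3" by simp
  define K where "K i = type_ideal.span (e ` set (take i xs))" for i
  define ys where "ys = map e (take 3 xs)"
  have length_ys: "length ys = 3" using len by (simp add: ys_def)
  have ys: "ys ! i = e (xs ! i)" if "i < 3" for i
    using that len by (simp add: ys_def)
  have K_mono: "K i \<subseteq> K j" if "i \<le> j" for i j
    unfolding K_def using that by (intro type_ideal.span_mono image_mono set_take_subset_set_take)
  from length_ys have "ys = [ys ! 0, ys ! 1, ys ! 2]"
    by (intro nth_equalityI) (auto simp: less_Suc_eq numeral_3_eq_3 numeral_2_eq_2)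
  then have "0 \<in> boundary_monoid ys"
    using zero_in_boundary_monoid_fps_fps by metis
  then have "1 \<in> K (length ys)"
  proof (rule boundary_monoid_chain[rotated 4])
    show "0 \<in> K 0" by (simp add: K_def type_ideal.span_zero)
    fix i
    show "type_ideal.subspace (K i)" by (simp add: K_def)
    assume i: "i < length ys"
    show "K i \<subseteq> K (Suc i)" by (rule K_mono) simp
    have "xs ! i \<in> set (take (Suc i) xs)"
      using i len length_ys by (simp add: in_set_conv_nth) (metis lessI nth_take)
    then show "ys ! i \<in> K (Suc i)"
      using ys[of i] i length_ys by (auto simp: K_def intro: type_ideal.span_base)
    show "b \<in> K i" if "ys ! i * b \<in> K i" for b
      using that assms i len length_ys ys unfolding regular_seq_quotient_module_iff K_def by simp
  qed
  then have "1 \<in> K (length xs)" using K_mono[of 3 "length xs"] len length_ys by auto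
  then show False using assms unfolding regular_seq_quotient_module_iff K_def by simp
qed

lemma const_coeff_eq_0_ideal:
  "type_ideal.subspace {f :: 'k fps fps. f $ 0 $ 0 = 0}"
  by (rule type_ideal.subspaceI) auto

text \<open>
  The two variables of the power series ring form a regular sequence.
\<close>

lemma exists_regular_seq: "\<exists>xs. regular_seq R M xs \<and> length xs = 2"
proof -
  obtain y where y: "y \<in> carrier R" "e y = fps_X" by (rule preimage)
  obtain x where x: "x \<in> carrier R" "e x = fps_const fps_X" by (rule preimage)
  have "1 \<notin> type_ideal.span {fps_X, fps_const fps_X :: 'k fps fps}"
    using type_ideal.span_minimal[OF _ const_coeff_eq_0_ideal, of "{fps_X, fps_const fps_X}"] by auto
  moreover have "b \<in> type_ideal.span {fps_X}"
    if "fps_const fps_X * b \<in> type_ideal.span {fps_X}" for b :: "'k fps fps"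
  proof -
    have span: "c \<in> type_ideal.span {fps_X} \<longleftrightarrow> fps_X dvd c" for c :: "'k fps fps"
      by (auto simp: type_ideal.span_singleton dvd_def mult.commute)
    show ?thesis using that unfolding span fps_X_dvd_iff by simp
  qed
  ultimately have "regular_seq R M [y, x]"
    unfolding regular_seq_quotient_module_iff using x y
    by (auto simp: less_Suc_eq insert_commute)
  then show ?thesis by (intro exI[of _ "[y, x]"]) simp
qed

lemma depth_quotient_module: "depth_module R M = 2"
  unfolding depth_module_def
proof (rule antisym)
  show "Sup {enat (length xs) | xs. regular_seq R M xs} \<le> 2"
    using length_regular_seq_le by (intro Sup_least) (auto simp: numeral_eq_enat)
  show "2 \<le> Sup {enat (length xs) | xs. regular_seq R M xs}"
    using exists_regular_seq by (intro Sup_upper) (auto simp: numeral_eq_enat)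
qed

text \<open>
  The preimages of \<open>0 \<subset> (t) \<subset> (s, t)\<close> form a chain of primes.
\<close>

lemma krull_dim_ge: "2 \<le> krull_dim R"
proof -
  define J :: "nat \<Rightarrow> 'k fps fps set"
    where "J i = (if i = 0 then {0} else if i = 1 then {f. f $ 0 = 0} else {f. f $ 0 $ 0 = 0})" for i
  define P where "P i = {r \<in> carrier R. e r \<in> J i}" for i
  have "primeideal (P i) R" for i
    unfolding P_def
  proof (rule primeideal_vimage)
    show "type_ideal.subspace (J i)"
      unfolding J_def using const_coeff_eq_0_ideal by (auto simp: type_ideal.subspace_def)
  qed (auto simp: J_def split: if_splits)
  moreover have "P i \<subset> P (Suc i)" if i: "i < 2" for i
  proof -
    define b :: "'k fps fps" where "b = (if i = 0 then fps_X else fps_const fps_X)"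
    have b: "b \<in> J (Suc i) - J i" using i by (auto simp: b_def J_def)
    obtain r where "r \<in> carrier R" "e r = b" by (rule preimage)
    with b have "r \<in> P (Suc i) - P i" by (simp add: P_def)
    moreover have "P i \<subseteq> P (Suc i)" using i by (auto simp: P_def J_def)
    ultimately show ?thesis by blast
  qed
  ultimately show ?thesis
    unfolding krull_dim_def by (intro Sup_upper) (auto simp: numeral_eq_enat)
qed

text \<open>
  Primes containing the kernel of \<open>e\<close> correspond to their images, and any \<open>x\<^sub>i \<in> P\<^sub>i\<^sub>+\<^sub>1 - P\<^sub>i\<close> is a
  non-zerodivisor modulo \<open>P\<^sub>i\<close>.
\<close>

lemma no_prime_chain_above_kernel:
  assumes P: "\<And>i. i \<le> 3 \<Longrightarrow> primeideal (P i) R" "\<And>i. i < 3 \<Longrightarrow> P i \<subset> P (Suc i)"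
    and ker: "\<And>r. r \<in> carrier R \<Longrightarrow> e r = 0 \<Longrightarrow> r \<in> P 0"
  shows False
proof -
  have P0: "P 0 \<subseteq> P i" if "i \<le> 3" for i
    using that
  proof (induction i)
    case (Suc i)
    then show ?case using P(2)[of i] by auto
  qed simp
  have mem: "r \<in> P i" if "e r \<in> e ` P i" "r \<in> carrier R" "i \<le> 3" for r i
  proof -
    interpret Pi: primeideal "P i" R by (rule P) fact
    from that obtain p where p: "p \<in> P i" "e r = e p" by auto
    have pc: "p \<in> carrier R" using p Pi.a_subset by auto
    have "r \<ominus> p \<in> P i" using P0[OF \<open>i \<le> 3\<close>] ker[of "r \<ominus> p"] that(2) p pc by (auto simp: a_minus_def)
    then have "(r \<ominus> p) \<oplus> p \<in> P i" using p by auto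
    then show ?thesis using that(2) pc by (simp add: a_minus_def R.a_assoc R.l_neg)
  qed
  have "\<forall>i\<in>{..<3}. \<exists>x. x \<in> P (Suc i) - P i" using P(2) by blast
  then obtain x where x: "\<And>i. i < 3 \<Longrightarrow> x i \<in> P (Suc i) - P i"
    by (metis lessThan_iff)
  have x_carrier: "x i \<in> carrier R" if "i < 3" for i
  proof -
    interpret Pi: primeideal "P (Suc i)" R by (rule P) (use that in simp)
    show ?thesis using x[OF that] Pi.a_subset by auto
  qed
  define ys where "ys = [e (x 0), e (x 1), e (x 2)]"
  have ys: "ys ! i = e (x i)" if "i < 3" for i
    using that by (auto simp: ys_def less_Suc_eq numeral_3_eq_3 numeral_2_eq_2)
  have length_ys: "length ys = 3" by (simp add: ys_def)
  have "0 \<in> boundary_monoid ys"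
    unfolding ys_def by (rule zero_in_boundary_monoid_fps_fps)
  then have "1 \<in> e ` P (length ys)"
  proof (rule boundary_monoid_chain[rotated 4])
    show "0 \<in> e ` P 0" using ker[OF R.zero_closed] by (metis e_zero imageI)
  next
    fix i assume "i \<le> length ys"
    then have i: "i \<le> 3" by (simp add: length_ys)
    interpret Pi: primeideal "P i" R by (rule P) fact
    show "type_ideal.subspace (e ` P i)"
    proof (rule type_ideal.subspaceI)
      show "0 \<in> e ` P i" using Pi.zero_closed e_zero by (metis imageI)
      show "a + b \<in> e ` P i" if "a \<in> e ` P i" "b \<in> e ` P i" for a b
        using that Pi.a_subset by (auto simp flip: e_add intro!: imageI)
      show "c * a \<in> e ` P i" if "a \<in> e ` P i" for c a
      proof -
        obtain r where "r \<in> carrier R" "e r = c" by (rule preimage)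
        then show ?thesis using that Pi.I_l_closed by (auto simp flip: e_mult intro!: imageI)
      qed
    qed
  next
    fix i assume "i < length ys"
    then have i: "i < 3" by (simp add: length_ys)
    show "e ` P i \<subseteq> e ` P (Suc i)" using P(2)[OF i] by blast
    show "ys ! i \<in> e ` P (Suc i)" using x[OF i] ys[OF i] by blast
    show "b \<in> e ` P i" if b: "ys ! i * b \<in> e ` P i" for b
    proof -
      interpret Pi: primeideal "P i" R by (rule P) (use i in simp)
      obtain r where r: "r \<in> carrier R" "e r = b" by (rule preimage)
      have "x i \<otimes> r \<in> P i"
        using mem[of "x i \<otimes> r" i] b r x_carrier[OF i] ys[OF i] i by simp
      then have "r \<in> P i" using Pi.I_prime[of "x i" r] r x_carrier[OF i] x[OF i] by blast
      then show ?thesis using r by blast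
    qed
  qed
  then have "\<one> \<in> P 3" using mem[of \<one> 3] by (simp add: length_ys)
  interpret P3: primeideal "P 3" R by (rule P) simp
  show False using P3.one_imp_carrier \<open>\<one> \<in> P 3\<close> P3.I_notcarr by blast
qed

end

section \<open>Annihilators, module closure, trace ideals and test ideals\<close>

definition tensor_generators ::
    "('r, 'e) ring_scheme \<Rightarrow> ('r, 'm, 'f) module_scheme \<Rightarrow> ('r, 'n, 'g) module_scheme
      \<Rightarrow> ('m \<times> 'n \<Rightarrow>\<^sub>0 int) set" where
  "tensor_generators R M N =
     {frag_of (x \<oplus>\<^bsub>M\<^esub> x', y) - frag_of (x, y) - frag_of (x', y) | x x' y.
         x \<in> carrier M \<and> x' \<in> carrier M \<and> y \<in> carrier N} \<union>
      {frag_of (x, y \<oplus>\<^bsub>N\<^esub> y') - frag_of (x, y) - frag_of (x, y') | x y y'.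
         x \<in> carrier M \<and> y \<in> carrier N \<and> y' \<in> carrier N} \<union>
      {frag_of (a \<odot>\<^bsub>M\<^esub> x, y) - frag_of (x, a \<odot>\<^bsub>N\<^esub> y) | a x y.
         a \<in> carrier R \<and> x \<in> carrier M \<and> y \<in> carrier N}"

lemma tensor_rels_eq_generate:
  "tensor_rels R M N = generate (free_Abelian_group (carrier M \<times> carrier N)) (tensor_generators R M N)"
  unfolding tensor_rels_def tensor_generators_def ..

lemma tensor_generators_subset:
  assumes M: "Module.module R M" and B: "Module.module R B" and A: "submodule A R B"
  shows "tensor_generators R M (B\<lparr>carrier := A\<rparr>) \<subseteq> carrier (free_Abelian_group (carrier M \<times> A))"
proof -
  interpret M: Module.module R M by fact
  interpret B: Module.module R B by fact
  note A = B.submoduleE[OF A]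
  have keys3: "frag_of p - frag_of q - frag_of r \<in> carrier (free_Abelian_group (carrier M \<times> A))"
    if "p \<in> carrier M \<times> A" "q \<in> carrier M \<times> A" "r \<in> carrier M \<times> A" for p q r :: "_ \<times> _"
    using that keys_diff[of "frag_of p - frag_of q" "frag_of r"] keys_diff[of "frag_of p" "frag_of q"]
    by auto
  have keys2: "frag_of p - frag_of q \<in> carrier (free_Abelian_group (carrier M \<times> A))"
    if "p \<in> carrier M \<times> A" "q \<in> carrier M \<times> A" for p q :: "_ \<times> _"
    using that keys_diff[of "frag_of p" "frag_of q"] by auto
  show ?thesis
    unfolding tensor_generators_def
    by (intro Un_least subsetI; elim CollectE exE conjE; hypsubst)
      (auto intro!: keys3 keys2 simp: A(4,5) simp del: carrier_free_Abelian_group_iff)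
qed

lemma subgroup_tensor_rels:
  assumes M: "Module.module R M" and B: "Module.module R B" and A: "submodule A R B"
  shows "subgroup (tensor_rels R M (B\<lparr>carrier := A\<rparr>)) (free_Abelian_group (carrier M \<times> A))"
  unfolding tensor_rels_eq_generate
  using group.generate_is_subgroup[OF group_free_Abelian_group tensor_generators_subset[OF assms]]
  by simp

lemma submodule_carrier:
  assumes "Module.module R B"
  shows "submodule (carrier B) R B"
proof -
  interpret Module.module R B by fact
  show ?thesis by (rule submoduleI) auto
qed

text \<open>
  Both groups of relations live in different free groups, but the generators for \<open>A\<close> are among those
  for \<open>B\<close>, and the inverse of an element is the same in both free groups.
\<close>

lemma tensor_rels_mono:
  assumes M: "Module.module R M" and B: "Module.module R B" and A: "submodule A R B"
  shows "tensor_rels R M (B\<lparr>carrier := A\<rparr>) \<subseteq> tensor_rels R M B"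
proof
  interpret B: Module.module R B by fact
  have AB: "A \<subseteq> carrier B" using B.submoduleE[OF A] by blast
  have gens: "tensor_generators R M (B\<lparr>carrier := A\<rparr>) \<subseteq> tensor_generators R M B"
    using AB unfolding tensor_generators_def by simp blast
  interpret T: subgroup "tensor_rels R M B" "free_Abelian_group (carrier M \<times> carrier B)"
    using subgroup_tensor_rels[OF M B submodule_carrier[OF B]] by simp
  fix c assume "c \<in> tensor_rels R M (B\<lparr>carrier := A\<rparr>)"
  then have "c \<in> generate (free_Abelian_group (carrier M \<times> A)) (tensor_generators R M (B\<lparr>carrier := A\<rparr>))"
    by (simp add: tensor_rels_eq_generate)
  then show "c \<in> tensor_rels R M B"
  proof induction
    case one
    then show ?case using T.one_closed by simp
  next
    case (incl h)
    then show ?case using gens unfolding tensor_rels_eq_generate by (blast intro: generate.incl)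
  next
    case (inv h)
    then have h: "Poly_Mapping.keys h \<subseteq> carrier M \<times> A"
      using subsetD[OF tensor_generators_subset[OF assms]]
      by (simp only: carrier_free_Abelian_group_iff)
    then have h': "Poly_Mapping.keys h \<subseteq> carrier M \<times> carrier B" using AB by blast
    have "h \<in> tensor_rels R M B"
      using inv gens unfolding tensor_rels_eq_generate by (blast intro: generate.incl)
    then have "inv\<^bsub>free_Abelian_group (carrier M \<times> carrier B)\<^esub> h \<in> tensor_rels R M B"
      by (rule T.m_inv_closed)
    then show ?case by (simp only: inv_free_Abelian_group[OF h] inv_free_Abelian_group[OF h'])
  next
    case (eng h1 h2)
    then show ?case using T.m_closed by simp
  qed
qed

text \<open>
  The reason is \<open>x \<otimes> u y = u x \<otimes> y = 0 \<otimes> y = 0\<close>, which lies in the image of every \<open>M \<otimes> A\<close>.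
\<close>

lemma smult_in_module_closure:
  assumes M: "Module.module R M" and B: "Module.module R B" and A: "submodule A R B"
    and u: "u \<in> carrier R" "\<And>x. x \<in> carrier M \<Longrightarrow> u \<odot>\<^bsub>M\<^esub> x = \<zero>\<^bsub>M\<^esub>"
    and y: "y \<in> carrier B"
  shows "u \<odot>\<^bsub>B\<^esub> y \<in> module_closure R M B A"
  unfolding module_closure_def
proof (intro CollectI conjI ballI)
  interpret M: Module.module R M by fact
  interpret B: Module.module R B by fact
  show "u \<odot>\<^bsub>B\<^esub> y \<in> carrier B" using u y by simp
  fix x assume x: "x \<in> carrier M"
  let ?G = "free_Abelian_group (carrier M \<times> carrier B)"
  let ?T = "tensor_rels R M B"
  let ?T\<^sub>A = "tensor_rels R M (B\<lparr>carrier := A\<rparr>)"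
  interpret T: subgroup ?T ?G
    using subgroup_tensor_rels[OF M B submodule_carrier[OF B]] by simp
  interpret TA: subgroup ?T\<^sub>A "free_Abelian_group (carrier M \<times> A)"
    by (rule subgroup_tensor_rels[OF M B A])
  have add: "p + q \<in> ?T" if "p \<in> ?T" "q \<in> ?T" for p q using T.m_closed that by simp
  have minus: "- p \<in> ?T" if "p \<in> ?T" for p
    using T.m_inv_closed[OF that] T.mem_carrier[OF that] by simp
  have "frag_of (\<zero>\<^bsub>M\<^esub> \<oplus>\<^bsub>M\<^esub> \<zero>\<^bsub>M\<^esub>, y) - frag_of (\<zero>\<^bsub>M\<^esub>, y) - frag_of (\<zero>\<^bsub>M\<^esub>, y) \<in> ?T"
    unfolding tensor_rels_eq_generate tensor_generators_def
    by (rule generate.incl) (use y in blast)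
  then have zero: "- frag_of (\<zero>\<^bsub>M\<^esub>, y) \<in> ?T" by simp
  have "frag_of (u \<odot>\<^bsub>M\<^esub> x, y) - frag_of (x, u \<odot>\<^bsub>B\<^esub> y) \<in> ?T"
    unfolding tensor_rels_eq_generate tensor_generators_def
    by (rule generate.incl) (use u(1) x y in blast)
  from minus[OF add[OF this zero]] have "frag_of (x, u \<odot>\<^bsub>B\<^esub> y) \<in> ?T"
    by (simp add: u(2)[OF x])
  then have "elem_tensor R M B x (u \<odot>\<^bsub>B\<^esub> y) = ?T"
    unfolding elem_tensor_def by (intro T.rcos_const group_free_Abelian_group)
  also have "?T = tensor_incl R M B ?T\<^sub>A"
  proof
    show "?T \<subseteq> tensor_incl R M B ?T\<^sub>A"
      unfolding tensor_incl_def set_mult_def using TA.one_closed by force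
    show "tensor_incl R M B ?T\<^sub>A \<subseteq> ?T"
      unfolding tensor_incl_def set_mult_def using tensor_rels_mono[OF M B A] add by auto
  qed
  moreover have "?T\<^sub>A \<in> carrier (tensor R M (B\<lparr>carrier := A\<rparr>))"
    using TA.subgroup_in_rcosets[OF group_free_Abelian_group]
    by (simp add: tensor_def FactGroup_def)
  ultimately show "elem_tensor R M B x (u \<odot>\<^bsub>B\<^esub> y) \<in>
      tensor_incl R M B ` carrier (tensor R M (B\<lparr>carrier := A\<rparr>))"
    by blast
qed

context surjection_onto_domain
begin

lemma MCM_quotient_module:
  assumes "depth_module R M = krull_dim R"
  shows "MCM R M"
  unfolding MCM_def
proof (intro conjI assms module_quotient_module fin_gen_quotient_module)
  have "enc 1 \<in> carrier M" "enc 1 \<noteq> \<zero>\<^bsub>M\<^esub>" by simp_all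
  then show "carrier M \<noteq> {\<zero>\<^bsub>M\<^esub>}" by blast
qed

lemma kernel_kills_quotient_module:
  assumes "e u = 0" "x \<in> carrier M"
  shows "u \<odot>\<^bsub>M\<^esub> x = \<zero>\<^bsub>M\<^esub>"
  using assms by auto

text \<open>
  A homomorphism \<open>f\<close> from \<open>M\<close> to \<open>R\<close> satisfies \<open>u f(x) = f(u x) = 0\<close>; apply \<open>e'\<close> and cancel \<open>e' u\<close> in
  the domain.
\<close>

lemma trace_ideal_quotient_module:
  assumes e': "surjection_onto_domain R e'"
    and u: "u \<in> carrier R" "e u = 0" "e' u \<noteq> 0"
    and r: "r \<in> trace_ideal R M"
  shows "e' r = 0"
proof -
  interpret E': surjection_onto_domain R e' by fact
  interpret M: Module.module R M by (rule module_quotient_module)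
  have "(\<Union>f\<in>module_homs R M (regular_module R). f ` carrier M) \<subseteq> {r \<in> carrier R. e' r \<in> {0}}"
  proof safe
    fix f x assume f: "f \<in> module_homs R M (regular_module R)" and x: "x \<in> carrier M"
    have fx: "f x \<in> carrier R"
      using f x by (auto simp: module_homs_def regular_module_def hom_def)
    have smult: "f (a \<odot>\<^bsub>M\<^esub> x) = a \<otimes> f x" if "a \<in> carrier R" for a
      using f x that by (simp add: module_homs_def regular_module_def del: quotient_module_simps)
    have "u \<otimes> f x = f (u \<odot>\<^bsub>M\<^esub> x)" using smult u by simp
    also have "\<dots> = f (\<zero> \<odot>\<^bsub>M\<^esub> x)"
      using kernel_kills_quotient_module[of _ x] u x e_zero by metis
    also have "\<dots> = \<zero>" using smult fx by simp
    finally have "e' u * e' (f x) = 0"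
      using E'.e_mult[OF u(1) fx] by simp
    then show "e' (f x) = 0" using u by simp
    show "f x \<in> carrier R" by fact
  qed
  then have "trace_ideal R M \<subseteq> {r \<in> carrier R. e' r \<in> {0}}"
    unfolding trace_ideal_def
    by (rule R.genideal_minimal[OF E'.ideal_vimage[OF type_ideal.subspace_single_0]])
  then show ?thesis using r by blast
qed

text \<open>
  Take for \<open>B\<close> the module of \<open>e'\<close> and \<open>A = 0\<close>.  The closure contains \<open>u\<close> times the generator of \<open>B\<close>, so an
  element \<open>r\<close> of the test ideal has \<open>e' r * e' u = 0\<close>.
\<close>

lemma test_ideal_quotient_module:
  assumes e': "surjection_onto_domain R e'"
    and u: "u \<in> carrier R" "e u = 0" "e' u \<noteq> 0"
    and r: "r \<in> test_ideal R M"
  shows "e' r = 0"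
proof -
  interpret E': surjection_onto_domain R e' by fact
  have sub: "submodule {E'.enc 0} R E'.M"
    using E'.submodule_enc_image[OF type_ideal.subspace_single_0] by simp
  have "u \<odot>\<^bsub>E'.M\<^esub> E'.enc 1 \<in> module_closure R M E'.M {E'.enc 0}"
    using u kernel_kills_quotient_module
    by (intro smult_in_module_closure module_quotient_module E'.module_quotient_module sub) auto
  moreover have "r \<in> module_colon R E'.M {E'.enc 0} (module_closure R M E'.M {E'.enc 0})"
    using r E'.module_quotient_module sub unfolding test_ideal_def by blast
  ultimately have "e' r * e' u = 0"
    unfolding module_colon_def by auto
  then show ?thesis using u by simp
qed

end

lemma zero_in_trace_ideal:
  assumes "Module.module R M"
  shows "\<zero>\<^bsub>R\<^esub> \<in> trace_ideal R M"
proof -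
  interpret Module.module R M by fact
  have "(\<Union>f\<in>module_homs R M (regular_module R). f ` carrier M) \<subseteq> carrier R"
    by (auto simp: module_homs_def regular_module_def hom_def)
  then interpret ideal "trace_ideal R M" R
    unfolding trace_ideal_def by (rule R.genideal_ideal)
  show ?thesis by (rule zero_closed)
qed

lemma zero_in_test_ideal:
  fixes R :: "'r ring"
  assumes "cring R"
  shows "\<zero>\<^bsub>R\<^esub> \<in> test_ideal R M"
proof -
  interpret cring R by fact
  have "\<zero>\<^bsub>R\<^esub> \<odot>\<^bsub>B\<^esub> c \<in> A"
    if B: "Module.module R B" and A: "submodule A R B" and c: "c \<in> module_closure R M B A"
    for B :: "'r univ_module" and A c
  proof -
    interpret B: Module.module R B by fact
    interpret A: submodule A R B by fact
    have "c \<in> carrier B" using c by (simp add: module_closure_def)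
    then show ?thesis using A.one_closed by simp
  qed
  then show ?thesis by (simp add: test_ideal_def module_colon_def)
qed

section \<open>Substituting a line into power series\<close>

text \<open>
  The series \<open>j x\<close> that is to be substituted for \<open>z\<close>.
\<close>

definition line :: "'k::field \<Rightarrow> 'k fps fps" where
  "line j = fps_const (fps_const j * fps_X)"

text \<open>
  The substitution \<open>z = j x\<close> in \<open>F = \<Sum>\<^sub>m F\<^sub>m z\<^sup>m\<close>, where \<open>F\<^sub>m \<in> k[[x]][[y]]\<close>: the sum \<open>\<Sum>\<^sub>m F\<^sub>m (j x)\<^sup>m\<close> is
  infinite, but each coefficient of the result involves only the terms with \<open>m \<le> a\<close>.
\<close>

definition eval_on_line :: "'k::field \<Rightarrow> 'k fps fps fps \<Rightarrow> 'k fps fps" where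
  "eval_on_line j F = Abs_fps (\<lambda>b. Abs_fps (\<lambda>a. \<Sum>m\<le>a. j ^ m * F $ m $ b $ (a - m)))"

definition line_factor :: "'k::field \<Rightarrow> 'k fps fps fps" where
  "line_factor j = fps_X - fps_const (line j)"

lemma line_mult_nth: "(line j * g) $ b $ a = (if a = 0 then 0 else j * g $ b $ (a - 1))"
  by (simp add: line_def mult.assoc)

lemma eval_on_line_step: "eval_on_line j F = F $ 0 + line j * eval_on_line j (fps_shift 1 F)"
proof (intro fps_ext)
  fix b a
  show "eval_on_line j F $ b $ a = (F $ 0 + line j * eval_on_line j (fps_shift 1 F)) $ b $ a"
  proof (cases a)
    case 0
    then show ?thesis by (simp add: eval_on_line_def line_mult_nth)
  next
    case (Suc c)
    then show ?thesis
      by (simp add: eval_on_line_def line_mult_nth sum.atMost_Suc_shift sum_distrib_left mult.assoc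
          del: sum.atMost_Suc)
  qed
qed

text \<open>
  Division by \<open>z - j x\<close> in Horner's manner: the coefficients of the quotient are the values of the tails
  of \<open>F\<close>.
\<close>

lemma factor_dvd_eval: "line_factor j dvd F - fps_const (eval_on_line j F)"
proof
  let ?G = "Abs_fps (\<lambda>n. eval_on_line j (fps_shift (Suc n) F))"
  show "F - fps_const (eval_on_line j F) = line_factor j * ?G"
  proof (rule fps_ext)
    fix n
    show "(F - fps_const (eval_on_line j F)) $ n = (line_factor j * ?G) $ n"
    proof (cases n)
      case 0
      then show ?thesis
        using eval_on_line_step[of j F] by (simp add: line_factor_def left_diff_distrib)
    next
      case (Suc m)
      have shift: "fps_shift (Suc 0) (fps_shift (Suc m) F) = fps_shift (Suc (Suc m)) F"
        by (intro fps_ext) simp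
      from Suc show ?thesis
        using eval_on_line_step[of j "fps_shift (Suc m) F"] shift
        by (simp add: line_factor_def left_diff_distrib)
    qed
  qed
qed

text \<open>
  If \<open>b = (z - j x) G\<close>, then comparing coefficients gives \<open>G\<^sub>n = j x G\<^sub>n\<^sub>+\<^sub>1\<close>, so every \<open>G\<^sub>n\<close> is divisible by all
  powers of \<open>x\<close>.
\<close>

lemma factor_dvd_const:
  assumes "line_factor j dvd fps_const b"
  shows "b = 0"
proof -
  obtain G where G: "fps_const b = line_factor j * G" using assms by (elim dvdE)
  have step: "G $ n = line j * G $ Suc n" for n
  proof -
    have "0 = (line_factor j * G) $ Suc n" unfolding G[symmetric] by simp
    also have "\<dots> = G $ n - line j * G $ Suc n" by (simp add: line_factor_def left_diff_distrib)
    finally show ?thesis by simp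
  qed
  have "G $ n $ y $ a = 0" for n y a
  proof (induction a arbitrary: n)
    case 0
    show ?case by (subst step) (simp add: line_mult_nth)
  next
    case (Suc a)
    then show ?case by (subst step) (simp add: line_mult_nth)
  qed
  then have "G = 0" by (intro fps_ext) simp
  then show ?thesis using G by simp
qed

text \<open>
  Uniqueness of the remainder characterises the value.  Compatibility with the ring operations
  follows from this without manipulating the defining double sum.
\<close>

lemma eval_on_line_eqI:
  assumes "line_factor j dvd F - fps_const b"
  shows "eval_on_line j F = b"
proof -
  have "line_factor j dvd (F - fps_const b) - (F - fps_const (eval_on_line j F))"
    by (intro dvd_diff assms factor_dvd_eval)
  then have "line_factor j dvd fps_const (eval_on_line j F - b)"
    by (simp flip: fps_const_sub)
  then show ?thesis using factor_dvd_const by fastforce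
qed

lemma eval_on_line_eq_0_iff: "eval_on_line j F = 0 \<longleftrightarrow> line_factor j dvd F"
  using factor_dvd_eval[of j F] eval_on_line_eqI[of j F 0] by auto

lemma eval_on_line_const [simp]: "eval_on_line j (fps_const b) = b"
  by (rule eval_on_line_eqI) simp

lemma eval_on_line_1 [simp]: "eval_on_line j 1 = 1"
  using eval_on_line_const[of j 1] by simp

lemma eval_on_line_X [simp]: "eval_on_line j fps_X = line j"
  by (rule eval_on_line_eqI) (simp add: line_factor_def)

lemma eval_on_line_add: "eval_on_line j (F + G) = eval_on_line j F + eval_on_line j G"
proof (rule eval_on_line_eqI)
  have "F + G - fps_const (eval_on_line j F + eval_on_line j G) =
      (F - fps_const (eval_on_line j F)) + (G - fps_const (eval_on_line j G))"
    by (simp flip: fps_const_add)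
  then show "line_factor j dvd F + G - fps_const (eval_on_line j F + eval_on_line j G)"
    by (metis dvd_add factor_dvd_eval)
qed

lemma eval_on_line_diff: "eval_on_line j (F - G) = eval_on_line j F - eval_on_line j G"
  using eval_on_line_add[of j "F - G" G] by simp

lemma eval_on_line_mult: "eval_on_line j (F * G) = eval_on_line j F * eval_on_line j G"
proof (rule eval_on_line_eqI)
  let ?f = "fps_const (eval_on_line j F)" and ?g = "fps_const (eval_on_line j G)"
  have "F * G - fps_const (eval_on_line j F * eval_on_line j G) =
      (F - ?f) * G + ?f * (G - ?g)"
    by (simp add: algebra_simps flip: fps_const_mult)
  then show "line_factor j dvd F * G - fps_const (eval_on_line j F * eval_on_line j G)"
    by (simp add: factor_dvd_eval dvd_add)
qed

lemma factor_mult_factor: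
  assumes "j ^ 2 = (-1 :: 'k::field)"
  shows "line_factor j * line_factor (- j) = var_x ^ 2 + var_z ^ 2"
proof -
  have neg: "line (- j) = - line j"
    by (simp add: line_def flip: fps_const_neg)
  have "line j * line j = - (fps_const fps_X ^ 2)"
  proof -
    have "line j * line j = fps_const (fps_const (j ^ 2) * fps_X ^ 2)"
      by (simp add: line_def power2_eq_square ac_simps flip: fps_const_mult)
    then show ?thesis unfolding assms by (simp add: fps_const_neg[symmetric] power2_eq_square del: fps_const_neg)
  qed
  then have "fps_const (line j) * fps_const (line j) = - (var_x ^ 2)"
    by (simp add: var_x_def power2_eq_square)
  then show ?thesis
    by (simp add: line_factor_def neg var_z_def algebra_simps power2_eq_square flip: fps_const_neg)
qed

text \<open>
  The value is \<open>-2 j x\<close>: the two branches differ away from characteristic two.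
\<close>

lemma eval_opposite_factor:
  fixes j :: "'k::field"
  assumes "(2 :: 'k) \<noteq> 0" "j \<noteq> 0"
  shows "eval_on_line (- j) (line_factor j) \<noteq> 0"
proof -
  have "eval_on_line (- j) (line_factor j) $ 0 $ 1 = - (2 * j)"
    by (simp add: line_factor_def eval_on_line_diff line_def)
  moreover have "2 * j \<noteq> 0" using assms by simp
  ultimately show ?thesis by (metis fps_zero_nth neg_equal_0_iff_equal)
qed

text \<open>
  Write \<open>F = (z - j x) G\<close>.  On the other branch the first factor is nonzero, so \<open>G\<close> vanishes there and is
  divisible by \<open>z + j x\<close>.
\<close>

lemma eval_on_both_lines_eq_0:
  fixes j :: "'k::field"
  assumes "j ^ 2 = -1" "(2 :: 'k) \<noteq> 0"
    and "eval_on_line j F = 0" "eval_on_line (- j) F = 0"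
  shows "var_x ^ 2 + var_z ^ 2 dvd F"
proof -
  obtain G where G: "F = line_factor j * G"
    using assms(3) unfolding eval_on_line_eq_0_iff by (elim dvdE)
  have "j \<noteq> 0" using assms(1) by auto
  then have "eval_on_line (- j) G = 0"
    using assms(4) eval_opposite_factor[OF assms(2)] unfolding G eval_on_line_mult by simp
  then have "line_factor (- j) dvd G" by (simp add: eval_on_line_eq_0_iff)
  then show ?thesis unfolding G factor_mult_factor[OF assms(1), symmetric] by simp
qed

section \<open>The two branches of the hypersurface\<close>

definition residue_class :: "'k::field fps fps fps \<Rightarrow> 'k fps fps fps set" where
  "residue_class F = {G. var_x ^ 2 + var_z ^ 2 dvd G - F}"

lemma hypersurface_quotient:
  shows cring_hypersurface: "cring (hypersurface :: 'k::field fps fps fps set ring)"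
    and residue_class_hom:
      "(residue_class :: 'k fps fps fps \<Rightarrow> _) \<in> ring_hom ring_of_type_algebra hypersurface"
    and carrier_hypersurface:
      "carrier (hypersurface :: 'k fps fps fps set ring) = range residue_class"
proof -
  let ?S = "ring_of_type_algebra :: 'k fps fps fps ring"
  let ?I = "Idl\<^bsub>?S\<^esub> {var_x ^ 2 + var_z ^ 2}"
  interpret S: cring ?S by (rule cring_from_type_algebra)
  have carrier: "carrier ?S = UNIV" by (simp add: ring_of_type_algebra_def)
  interpret I: ideal ?I ?S by (rule S.genideal_ideal) (simp add: carrier)
  have "?I = PIdl\<^bsub>?S\<^esub> (var_x ^ 2 + var_z ^ 2)"
    by (rule S.cgenideal_eq_genideal[symmetric]) (simp add: carrier)
  also have "\<dots> = {F. var_x ^ 2 + var_z ^ 2 dvd F}"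
    by (auto simp: cgenideal_def ring_of_type_algebra_def dvd_def mult.commute)
  finally have I: "?I = {F. var_x ^ 2 + var_z ^ 2 dvd F}" .
  have coset: "?I +>\<^bsub>?S\<^esub> F = residue_class F" for F
  proof -
    have "?I +>\<^bsub>?S\<^esub> F = (\<Union>h\<in>?I. {h + F})"
      by (simp add: a_r_coset_def' ring_of_type_algebra_def)
    also have "\<dots> = residue_class F"
    proof safe
      fix G assume "G \<in> residue_class F"
      then have "G - F \<in> ?I" unfolding I residue_class_def by simp
      then show "G \<in> (\<Union>h\<in>?I. {h + F})" by force
    qed (simp_all add: residue_class_def I)
    finally show ?thesis .
  qed
  show "cring (hypersurface :: 'k fps fps fps set ring)"
    unfolding hypersurface_def by (rule I.quotient_is_cring) (rule S.is_cring)
  show "(residue_class :: 'k fps fps fps \<Rightarrow> _) \<in> ring_hom ?S hypersurface"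
    using I.rcos_ring_hom unfolding hypersurface_def coset .
  show "carrier (hypersurface :: 'k fps fps fps set ring) = range residue_class"
    unfolding hypersurface_def FactRing_simps by (auto simp: carrier coset)
qed

text \<open>
  Evaluation is constant on residue classes if \<open>j\<^sup>2 = -1\<close>, so the image of a class is a singleton.
\<close>

definition eval_class :: "'k::field \<Rightarrow> 'k fps fps fps set \<Rightarrow> 'k fps fps" where
  "eval_class j C = the_elem (eval_on_line j ` C)"

lemma eval_residue_class:
  assumes "j ^ 2 = -1"
  shows "eval_class j (residue_class F) = eval_on_line j F"
proof -
  have "eval_on_line j G = eval_on_line j F" if "G \<in> residue_class F" for G
  proof -
    have "line_factor j dvd G - F"
      using that unfolding residue_class_def factor_mult_factor[OF assms, symmetric]
      by (auto dest: dvd_mult_left)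
    then have "eval_on_line j (G - F) = 0" by (simp add: eval_on_line_eq_0_iff)
    then show ?thesis by (simp add: eval_on_line_diff)
  qed
  moreover have "F \<in> residue_class F" by (simp add: residue_class_def)
  ultimately have "eval_on_line j ` residue_class F = {eval_on_line j F}" by blast
  then show ?thesis by (simp add: eval_class_def)
qed

lemma residue_class_ops:
  fixes F G :: "'k::field fps fps fps"
  shows "residue_class F \<oplus>\<^bsub>hypersurface\<^esub> residue_class G = residue_class (F + G)"
    and "residue_class F \<otimes>\<^bsub>hypersurface\<^esub> residue_class G = residue_class (F * G)"
    and "\<one>\<^bsub>hypersurface\<^esub> = residue_class (1 :: 'k fps fps fps)"
    and "\<zero>\<^bsub>hypersurface\<^esub> = residue_class (0 :: 'k fps fps fps)"
proof -
  have carrier: "carrier (ring_of_type_algebra :: 'k fps fps fps ring) = UNIV"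
    by (simp add: ring_of_type_algebra_def)
  interpret ring_hom_ring "ring_of_type_algebra :: 'k fps fps fps ring" hypersurface residue_class
    by (intro ring_hom_ringI2 ring_from_type_algebra cring.axioms(1)[OF cring_hypersurface]
        residue_class_hom)
  show "residue_class F \<oplus>\<^bsub>hypersurface\<^esub> residue_class G = residue_class (F + G)"
    using hom_add[of F G] by (simp add: ring_of_type_algebra_def)
  show "residue_class F \<otimes>\<^bsub>hypersurface\<^esub> residue_class G = residue_class (F * G)"
    using hom_mult[of F G] by (simp add: ring_of_type_algebra_def)
  show "\<one>\<^bsub>hypersurface\<^esub> = residue_class (1 :: 'k fps fps fps)"
    using hom_one by (simp add: ring_of_type_algebra_def)
  show "\<zero>\<^bsub>hypersurface\<^esub> = residue_class (0 :: 'k fps fps fps)"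
    using hom_zero by (simp add: ring_of_type_algebra_def)
qed

lemma surjection_eval_class:
  assumes "j ^ 2 = (-1 :: 'k::field)"
  shows "surjection_onto_fps_fps (hypersurface :: 'k fps fps fps set ring) (eval_class j)"
proof -
  note eval = eval_residue_class[OF assms]
  interpret cring "hypersurface :: 'k fps fps fps set ring" by (rule cring_hypersurface)
  have "eval_class j \<in> ring_hom (hypersurface :: 'k fps fps fps set ring) ring_of_type_algebra"
    by (rule ring_hom_memI)
      (auto simp: carrier_hypersurface residue_class_ops eval ring_of_type_algebra_def
        eval_on_line_add eval_on_line_mult)
  moreover have "eval_class j ` carrier (hypersurface :: 'k fps fps fps set ring) = UNIV"
  proof -
    have "b \<in> eval_class j ` range residue_class" for b
      using eval[of "fps_const b"] by (metis eval_on_line_const rangeI imageI)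
    then show ?thesis by (auto simp: carrier_hypersurface)
  qed
  ultimately show ?thesis by unfold_locales
qed

text \<open>
  Every prime contains the product \<open>(z - j x) (z + j x) = 0\<close>, hence one of its factors, so every chain of
  primes lies over one of the two branches.
\<close>

lemma krull_dim_hypersurface:
  assumes "j ^ 2 = (-1 :: 'k::field)"
  shows "krull_dim (hypersurface :: 'k fps fps fps set ring) = 2"
proof (rule antisym)
  let ?R = "hypersurface :: 'k fps fps fps set ring"
  interpret E: surjection_onto_fps_fps ?R "eval_class j"
    by (rule surjection_eval_class) fact
  show "2 \<le> krull_dim ?R" by (rule E.krull_dim_ge)
  have "n \<le> 2" if P: "\<forall>i\<le>n. primeideal (P i) ?R" "\<forall>i<n. P i \<subset> P (Suc i)"
    for n and P :: "nat \<Rightarrow> 'k fps fps fps set set"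
  proof (rule ccontr)
    assume n: "\<not> n \<le> 2"
    interpret P0: primeideal "P 0" ?R using P by blast
    have "residue_class (line_factor j) \<otimes>\<^bsub>?R\<^esub> residue_class (line_factor (- j)) = \<zero>\<^bsub>?R\<^esub>"
      unfolding residue_class_ops factor_mult_factor[OF assms]
      by (auto simp: residue_class_def dest: dvd_add[OF _ dvd_refl])
    then have "residue_class (line_factor j) \<in> P 0 \<or> residue_class (line_factor (- j)) \<in> P 0"
      using P0.I_prime[of "residue_class (line_factor j)" "residue_class (line_factor (- j))"]
      by (simp add: carrier_hypersurface)
    then obtain i where i: "i ^ 2 = -1" "residue_class (line_factor i) \<in> P 0"
      using assms by (metis power2_minus)
    interpret E': surjection_onto_fps_fps ?R "eval_class i"
      by (rule surjection_eval_class) fact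
    show False
    proof (rule E'.no_prime_chain_above_kernel)
      show "primeideal (P l) ?R" if "l \<le> 3" for l using P n that by auto
      show "P l \<subset> P (Suc l)" if "l < 3" for l using P n that by auto
      fix r assume "r \<in> carrier ?R" "eval_class i r = 0"
      then obtain F where "r = residue_class F" "eval_on_line i F = 0"
        by (auto simp: carrier_hypersurface eval_residue_class[OF i(1)])
      then obtain G where "r = residue_class (line_factor i) \<otimes>\<^bsub>?R\<^esub> residue_class G"
        unfolding eval_on_line_eq_0_iff by (auto simp: residue_class_ops elim!: dvdE)
      then show "r \<in> P 0" using i(2) by (simp add: P0.I_r_closed carrier_hypersurface)
    qed
  qed
  then show "krull_dim ?R \<le> 2"
    unfolding krull_dim_def by (intro Sup_least) (auto simp: numeral_eq_enat)
qed

theorem proposition6p2: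
  assumes "CHAR('k::alg_closed_field) \<noteq> 2"
  shows "tau_MCM test_ideal (hypersurface :: 'k fps fps fps set ring) =
           {\<zero>\<^bsub>(hypersurface :: 'k fps fps fps set ring)\<^esub>}
       \<and> tau_MCM trace_ideal (hypersurface :: 'k fps fps fps set ring) =
           {\<zero>\<^bsub>(hypersurface :: 'k fps fps fps set ring)\<^esub>}"
proof -
  let ?R = "hypersurface :: 'k fps fps fps set ring"
  obtain i :: 'k where i: "i ^ 2 = -1"
    using nth_root_exists[of 2 "-1 :: 'k"] by auto
  have two: "(2 :: 'k) \<noteq> 0"
  proof
    assume "(2 :: 'k) = 0"
    then have "of_nat 2 = (0 :: 'k)" by simp
    then have "CHAR('k) dvd 2" by (simp only: of_nat_eq_0_iff_char_dvd)
    then have "CHAR('k) = 1 \<or> CHAR('k) = 2" using two_is_prime_nat unfolding prime_nat_iff by blast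
    then show False using assms by simp
  qed
  interpret R: cring ?R by (rule cring_hypersurface)
  have vanish: "r = \<zero>\<^bsub>?R\<^esub>" if r: "r \<in> carrier ?R" and eval: "\<And>j. j ^ 2 = -1 \<Longrightarrow> eval_class j r = 0" for r
  proof -
    obtain F where F: "r = residue_class F" using r unfolding carrier_hypersurface by blast
    have "eval_on_line j F = 0" if "j ^ 2 = -1" for j
      using eval[OF that] by (simp add: F eval_residue_class[OF that])
    then have "var_x ^ 2 + var_z ^ 2 dvd F" using i
      by (intro eval_on_both_lines_eq_0[OF i two]) simp_all
    then show ?thesis
      by (auto simp: F residue_class_ops residue_class_def dvd_diff_left_iff)
  qed
  \<comment> \<open>The module that detects vanishing on the branch \<open>z = j x\<close> is the one of the opposite branch.\<close>
  have branch: "\<exists>M :: ('k fps fps fps set) univ_module. MCM ?R M \<and>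
      (\<forall>r\<in>test_ideal ?R M. eval_class j r = 0) \<and> (\<forall>r\<in>trace_ideal ?R M. eval_class j r = 0)"
    if j: "j ^ 2 = -1" for j
  proof -
    have mj: "(- j) ^ 2 = -1" using j by simp
    interpret E: surjection_onto_fps_fps ?R "eval_class (- j)" by (rule surjection_eval_class[OF mj])
    interpret E': surjection_onto_fps_fps ?R "eval_class j" by (rule surjection_eval_class[OF j])
    define u where "u = residue_class (line_factor (- j))"
    have "- j \<noteq> 0" using mj by auto
    have u: "u \<in> carrier ?R" "eval_class (- j) u = 0" "eval_class j u \<noteq> 0"
      using eval_opposite_factor[OF two \<open>- j \<noteq> 0\<close>]
      by (auto simp: u_def carrier_hypersurface eval_residue_class j eval_on_line_eq_0_iff)
    note * = E'.surjection_onto_domain_axioms u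
    have "MCM ?R E.M"
      by (rule E.MCM_quotient_module) (simp add: E.depth_quotient_module krull_dim_hypersurface[OF i])
    then show ?thesis
      using E.test_ideal_quotient_module[OF *] E.trace_ideal_quotient_module[OF *] by blast
  qed
  have "r = \<zero>\<^bsub>?R\<^esub>" if "r \<in> tau_MCM test_ideal ?R" for r
    using that branch unfolding tau_MCM_def by (intro vanish) blast+
  moreover have "r = \<zero>\<^bsub>?R\<^esub>" if "r \<in> tau_MCM trace_ideal ?R" for r
    using that branch unfolding tau_MCM_def by (intro vanish) blast+
  moreover have "\<zero>\<^bsub>?R\<^esub> \<in> tau_MCM test_ideal ?R"
    by (simp add: tau_MCM_def zero_in_test_ideal R.is_cring)
  moreover have "\<zero>\<^bsub>?R\<^esub> \<in> tau_MCM trace_ideal ?R"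
    by (simp add: tau_MCM_def zero_in_trace_ideal MCM_def)
  ultimately show ?thesis by blast
qed

end
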